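(* Let $(\xi_j)$ be a homogeneous Markov chain on a Riemannian manifold $\mathcal X$ with Markov operator $$Rg(x)=\int_{\mathcal X}p(x,y)g(y)\,dy,$$ where $dy$ is the volume measure and $p(x,y)$ is a positive measurable function which is bounded and bounded away from $0$. Let $f:\mathcal X\to\mathbb R$ be bounded and Hölder continuous with exponent $\alpha\in(0,1]$, let $S_n=\sum_{j=1}^n(f(\xi_j)-\mathbb E[f(\xi_j)])$ and suppose $\lim_{n\to\infty}\frac1n\mathrm{Var}(S_n)>0$. Put $\sigma_n=\|S_n\|_{L^2}$ and $f_n(t)=\mathbb E[e^{itS_n/\sigma_n}]$. Then for every integer $m\ge3$ with $m-2<\frac{1+\alpha}{1-\alpha}$ (where $\frac{1+\alpha}{1-\alpha}=\infty$ when $\alpha=1$) and for every $c>0$ (small enough) and $B>0$ (large enough), $$\int_{c\sigma_n\le|t|\le B\sigma_n^{m-2}}\left|\frac{f_n^{(m)}(t)}{t}\right|dt=o(\sigma_n^{-(m-2)}).$$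
   Context: $Rg(x)=\mathbb E[g(\xi_1)\mid\xi_0=x]$. The chain need not be stationary. $f_n^{(m)}$ denotes the $m$-th derivative of $f_n$. *)

theory Defs
  imports "HOL-Probability.Probability" "HOL-Library.Landau_Symbols"
begin

text \<open>\<open>C\<^sup>k\<close> and \<open>C\<^sup>\<infinity>\<close> maps; these are meant for open sets \<open>S\<close>.\<close>

fun Ck_on :: "nat \<Rightarrow> (real^'n) set \<Rightarrow> (real^'n \<Rightarrow> 'b::real_normed_vector) \<Rightarrow> bool" where
  "Ck_on 0 S f \<longleftrightarrow> continuous_on S f"
| "Ck_on (Suc k) S f \<longleftrightarrow>
     (\<forall>u\<in>S. f differentiable (at u)) \<and> (\<forall>v. Ck_on k S (\<lambda>u. frechet_derivative f (at u) v))"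

definition smooth_on :: "(real^'n) set \<Rightarrow> (real^'n \<Rightarrow> 'b::real_normed_vector) \<Rightarrow> bool" where
  "smooth_on S f \<longleftrightarrow> (\<forall>k. Ck_on k S f)"

text \<open>A chart is a pair \<open>(U, \<phi>)\<close>; the values of \<open>\<phi>\<close> outside its domain \<open>U\<close> are irrelevant.
  The underlying space of the manifold is the whole type \<open>'x\<close>.\<close>

type_synonym ('x, 'n) chart = "'x set \<times> ('x \<Rightarrow> real^'n)"

definition is_chart :: "('x::topological_space, 'n::finite) chart \<Rightarrow> bool" where
  "is_chart = (\<lambda>(U, \<phi>). open U \<and> open (\<phi> ` U) \<and> homeomorphism U (\<phi> ` U) \<phi> (inv_into U \<phi>))"

definition transition :: "('x, 'n) chart \<Rightarrow> ('x, 'n) chart \<Rightarrow> real^'n \<Rightarrow> real^'n" where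
  "transition = (\<lambda>(U, \<phi>) (V, \<psi>). \<psi> \<circ> inv_into U \<phi>)"

definition smooth_atlas :: "('x::topological_space, 'n::finite) chart set \<Rightarrow> bool" where
  "smooth_atlas A \<longleftrightarrow>
     (\<forall>c\<in>A. is_chart c) \<and> (\<Union>c\<in>A. fst c) = UNIV \<and>
     (\<forall>c\<in>A. \<forall>d\<in>A. smooth_on (snd c ` (fst c \<inter> fst d)) (transition c d))"

text \<open>A Riemannian metric is given by its coordinate matrices: \<open>G c u\<close> is the Gram matrix of the
  coordinate vector fields of the chart \<open>c\<close> at the point with coordinates \<open>u\<close>. The last clause
  is the transformation law of a covariant 2-tensor under a change of chart.\<close>

definition riemannian_metric ::
  "('x::topological_space, 'n::finite) chart set \<Rightarrow> (('x, 'n) chart \<Rightarrow> real^'n \<Rightarrow> real^'n^'n) \<Rightarrow> bool" where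
  "riemannian_metric A G \<longleftrightarrow>
     (\<forall>c\<in>A. smooth_on (snd c ` fst c) (G c) \<and>
        (\<forall>u\<in>snd c ` fst c. transpose (G c u) = G c u \<and> (\<forall>v. v \<noteq> 0 \<longrightarrow> v \<bullet> (G c u *v v) > 0))) \<and>
     (\<forall>c\<in>A. \<forall>d\<in>A. \<forall>x \<in> fst c \<inter> fst d.
        let J = matrix (frechet_derivative (transition c d) (at (snd c x)))
        in G c (snd c x) = transpose J ** G d (snd d x) ** J)"

definition riemannian_manifold ::
  "('x::{t2_space,second_countable_topology}, 'n::finite) chart set
     \<Rightarrow> (('x, 'n) chart \<Rightarrow> real^'n \<Rightarrow> real^'n^'n) \<Rightarrow> bool" where
  "riemannian_manifold A G \<longleftrightarrow>
     connected (UNIV :: 'x set) \<and> smooth_atlas A \<and> riemannian_metric A G"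

text \<open>The volume measure, characterised by its density \<open>sqrt (det G)\<close> in charts. This determines
  the measure uniquely, since countably many chart domains cover the manifold.\<close>

definition is_riemannian_volume ::
  "('x::topological_space, 'n::finite) chart set \<Rightarrow> (('x, 'n) chart \<Rightarrow> real^'n \<Rightarrow> real^'n^'n)
     \<Rightarrow> 'x measure \<Rightarrow> bool" where
  "is_riemannian_volume A G vol \<longleftrightarrow>
     sets vol = sets borel \<and>
     (\<forall>c\<in>A. \<forall>B\<in>sets borel. B \<subseteq> fst c \<longrightarrow>
        emeasure vol B = (\<integral>\<^sup>+u\<in>snd c ` B. ennreal (sqrt (det (G c u))) \<partial>lborel))"

text \<open>The norm of the velocity of \<open>\<gamma>\<close> at time \<open>t\<close>. By the transformation law it does not depend
  on the chart around \<open>\<gamma> t\<close> in which it is computed.\<close>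

definition riemannian_speed ::
  "('x, 'n::finite) chart set \<Rightarrow> (('x, 'n) chart \<Rightarrow> real^'n \<Rightarrow> real^'n^'n)
     \<Rightarrow> (real \<Rightarrow> 'x) \<Rightarrow> real \<Rightarrow> real" where
  "riemannian_speed A G \<gamma> t =
     (let c = (SOME c. c \<in> A \<and> \<gamma> t \<in> fst c);
          w = vector_derivative (snd c \<circ> \<gamma>) (at t)
      in sqrt (w \<bullet> (G c (snd c (\<gamma> t)) *v w)))"

text \<open>The length is a nonnegative integral, because \<open>piecewise_C1_differentiable_on\<close> puts no bound on
  the velocity near the break points: curves of infinite length have to get length \<open>\<infinity>\<close>.\<close>

definition riemannian_length ::
  "('x, 'n::finite) chart set \<Rightarrow> (('x, 'n) chart \<Rightarrow> real^'n \<Rightarrow> real^'n^'n)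
     \<Rightarrow> (real \<Rightarrow> 'x) \<Rightarrow> ennreal" where
  "riemannian_length A G \<gamma> = (\<integral>\<^sup>+t\<in>{0..1}. ennreal (riemannian_speed A G \<gamma> t) \<partial>lborel)"

definition piecewise_C1_curve ::
  "('x::topological_space, 'n::finite) chart set \<Rightarrow> (real \<Rightarrow> 'x) \<Rightarrow> bool" where
  "piecewise_C1_curve A \<gamma> \<longleftrightarrow>
     path \<gamma> \<and>
     (\<forall>c\<in>A. \<forall>a b. 0 \<le> a \<and> a < b \<and> b \<le> 1 \<and> \<gamma> ` {a..b} \<subseteq> fst c \<longrightarrow>
        (snd c \<circ> \<gamma>) piecewise_C1_differentiable_on {a..b})"

text \<open>On a connected manifold the infimum below is finite, so \<open>enn2real\<close> is harmless.\<close>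

definition riemannian_dist ::
  "('x::topological_space, 'n::finite) chart set \<Rightarrow> (('x, 'n) chart \<Rightarrow> real^'n \<Rightarrow> real^'n^'n)
     \<Rightarrow> 'x \<Rightarrow> 'x \<Rightarrow> real" where
  "riemannian_dist A G x y =
     enn2real (INF \<gamma> \<in> {\<gamma>. piecewise_C1_curve A \<gamma> \<and> pathstart \<gamma> = x \<and> pathfinish \<gamma> = y}.
       riemannian_length A G \<gamma>)"

definition hoelder_continuous :: "('x \<Rightarrow> 'x \<Rightarrow> real) \<Rightarrow> real \<Rightarrow> ('x \<Rightarrow> real) \<Rightarrow> bool" where
  "hoelder_continuous d \<alpha> f \<longleftrightarrow> (\<exists>C. \<forall>x y. \<bar>f x - f y\<bar> \<le> C * d x y powr \<alpha>)"

definition transition_density :: "'x::topological_space measure \<Rightarrow> ('x \<Rightarrow> 'x \<Rightarrow> real) \<Rightarrow> bool" where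
  "transition_density vol p \<longleftrightarrow>
     (\<lambda>(x, y). p x y) \<in> borel_measurable (borel \<Otimes>\<^sub>M borel) \<and>
     (\<forall>x y. p x y > 0) \<and> (\<forall>x. (\<integral>\<^sup>+y. ennreal (p x y) \<partial>vol) = 1)"

definition markov_operator ::
  "'x measure \<Rightarrow> ('x \<Rightarrow> 'x \<Rightarrow> real) \<Rightarrow> ('x \<Rightarrow> real) \<Rightarrow> 'x \<Rightarrow> real" where
  "markov_operator vol p g x = (\<integral>y. p x y * g y \<partial>vol)"

definition past_algebra ::
  "'w measure \<Rightarrow> (nat \<Rightarrow> 'w \<Rightarrow> 'x::topological_space) \<Rightarrow> nat \<Rightarrow> 'w measure" where
  "past_algebra M \<xi> n =
     vimage_algebra (space M) (\<lambda>\<omega>. \<lambda>i\<in>{..n}. \<xi> i \<omega>) (\<Pi>\<^sub>M i\<in>{..n}. borel)"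

definition homogeneous_markov_chain ::
  "'w measure \<Rightarrow> (nat \<Rightarrow> 'w \<Rightarrow> 'x::topological_space) \<Rightarrow> (('x \<Rightarrow> real) \<Rightarrow> 'x \<Rightarrow> real) \<Rightarrow> bool" where
  "homogeneous_markov_chain M \<xi> R \<longleftrightarrow>
     prob_space M \<and> (\<forall>n. \<xi> n \<in> borel_measurable M) \<and>
     (\<forall>n. \<forall>g \<in> borel_measurable borel. bounded (range g) \<longrightarrow>
        (AE \<omega> in M. real_cond_exp M (past_algebra M \<xi> n) (\<lambda>\<omega>. g (\<xi> (Suc n) \<omega>)) \<omega> = R g (\<xi> n \<omega>)))"

definition centered_sum ::
  "'w measure \<Rightarrow> (nat \<Rightarrow> 'w \<Rightarrow> 'x) \<Rightarrow> ('x \<Rightarrow> real) \<Rightarrow> nat \<Rightarrow> 'w \<Rightarrow> real" where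
  "centered_sum M \<xi> f n \<omega> =
     (\<Sum>j=1..n. f (\<xi> j \<omega>) - prob_space.expectation M (\<lambda>\<omega>. f (\<xi> j \<omega>)))"

definition L2_norm :: "'w measure \<Rightarrow> ('w \<Rightarrow> real) \<Rightarrow> real" where
  "L2_norm M X = sqrt (\<integral>\<omega>. (X \<omega>)\<^sup>2 \<partial>M)"

definition normalized_char ::
  "'w measure \<Rightarrow> (nat \<Rightarrow> 'w \<Rightarrow> real) \<Rightarrow> nat \<Rightarrow> real \<Rightarrow> complex" where
  "normalized_char M S n t =
     prob_space.expectation M (\<lambda>\<omega>. exp (\<i> * complex_of_real (t * S n \<omega> / L2_norm M (S n))))"

definition nth_derivative :: "nat \<Rightarrow> (real \<Rightarrow> complex) \<Rightarrow> real \<Rightarrow> complex" where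
  "nth_derivative m = (\<lambda>h t. vector_derivative h (at t)) ^^ m"

end

theory Submission
  imports Defs "HOL-Complex_Analysis.Cauchy_Integral_Formula" "HOL-Real_Asymp.Real_Asymp"
begin

text \<open>
  The characteristic function of \<open>S\<^sub>n\<close> is entire, so by Cauchy's inequality its derivatives at a real
  frequency \<open>s\<close> are controlled by its size on a small complex disc around \<open>s\<close>. Since the density is
  bounded below by \<open>\<delta>\<close>, two steps of the chain weighted by \<open>exp (\<i> s f)\<close> lose a factor
  \<open>1 - const * \<eta>\<close> as soon as the integral of \<open>exp (\<i> s f)\<close> against the volume has absolute value at most
  \<open>vol - \<eta>\<close>. This persists on a disc of radius proportional to \<open>\<eta>\<close>.

  As \<open>f\<close> is not constant, it takes an interval of values along some segment in a chart. For
  large \<open>s\<close> the phase \<open>s f\<close> passes about \<open>s\<close> times through any prescribed residue modulo \<open>2 \<pi>\<close>, and by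
  Hoelder continuity it stays close to it for a time of order \<open>s powr (- 1 / \<alpha>)\<close>. Averaging over parallel
  segments gives \<open>\<eta>\<close> of order \<open>s powr (- \<beta>)\<close> with \<open>\<beta> = 1 / \<alpha> - 1\<close>, in every dimension.

  The frequencies \<open>t / \<sigma>\<^sub>n\<close> are at most of order \<open>n powr ((m - 3) / 2)\<close>, so the characteristic function and its
  derivatives are bounded there by a power of \<open>n\<close> times \<open>exp (- const * n powr (1 - \<beta> (m - 3) / 2))\<close>. The
  exponent is positive precisely when \<open>m - 2 < (1 + \<alpha>) / (1 - \<alpha>)\<close>.
\<close>

subsection \<open>Oscillation of Hoelder functions\<close>

lemma cos_le_zero_near_odd_pi:
  fixes x :: real
  assumes "\<bar>x - (pi + 2 * pi * of_int k)\<bar> \<le> pi / 2"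
  shows "cos x \<le> 0"
proof -
  define y where "y = x - pi - 2 * pi * of_int k"
  have x: "x = (y + pi) + 2 * pi * of_int k" by (simp add: y_def)
  have "cos x = - cos y"
    unfolding x cos_add[of "y + pi"] using cos_int_2pin[of k] sin_int_2pin[of k] by simp
  moreover have "cos y \<ge> 0"
    using assms unfolding abs_le_iff y_def by (intro cos_ge_zero) linarith+
  ultimately show ?thesis by simp
qed

text \<open>By the intermediate value theorem \<open>g\<close> attains every value between
  \<open>a\<close> and \<open>b\<close> at which the phase \<open>s * g t - \<theta>\<close> is an
  odd multiple of \<open>pi\<close>, and there are about \<open>s * (b - a) / (2 * pi)\<close> of
  them. After each such hit, Hoelder continuity keeps the phase within \<open>pi / 2\<close> of that
  multiple for a time \<open>r\<close>, so the cosine stays nonpositive there. Counting these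
  disjoint intervals gives the bound.\<close>

lemma oscillation_interval:
  fixes g :: "real \<Rightarrow> real" and \<alpha> C a b s \<theta> :: real
  assumes \<alpha>: "0 < \<alpha>" and C: "0 < C" and s: "0 < s"
    and cont: "continuous_on {0..1} g"
    and hoel: "\<And>t t'. t \<in> {0..1} \<Longrightarrow> t' \<in> {0..1} \<Longrightarrow> \<bar>g t - g t'\<bar> \<le> C * \<bar>t - t'\<bar> powr \<alpha>"
    and ab: "g 0 \<le> a" "b \<le> g 1" "a < b"
    and s1: "4 * pi \<le> s * (b - a)" and s2: "(pi / (2 * C * s)) powr (1 / \<alpha>) \<le> 1 / 2"
  shows "ennreal (s * (b - a) / (4 * pi) * (pi / (2 * C * s)) powr (1 / \<alpha>))
    \<le> emeasure lborel {t \<in> {0..1}. cos (s * g t - \<theta>) \<le> 0}"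
proof -
  \<comment> \<open>\<open>r\<close> is the solution of
    \<open>s * (C * r powr \<alpha>) = pi / 2\<close>: during a time \<open>r\<close> the phase
    moves by at most \<open>pi / 2\<close>.\<close>
  define r where "r = (pi / (2 * C * s)) powr (1 / \<alpha>)"
  define N where "N = nat \<lfloor>s * (b - a) / (2 * pi)\<rfloor>"
  \<comment> \<open>\<open>k0\<close> is the least integer for which the target value
    \<open>v 0\<close> is at least \<open>a\<close>; the further targets \<open>v k\<close> follow
    at distance \<open>2 * pi / s\<close>.\<close>
  define k0 where "k0 = \<lceil>(s * a - \<theta> - pi) / (2 * pi)\<rceil>"
  define v where "v k = (\<theta> + pi + 2 * pi * of_int (k0 + int k)) / s" for k :: nat
  have r: "0 < r" "r \<le> 1 / 2" using s2 C s by (auto simp: r_def)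
  have ralpha: "r powr \<alpha> = pi / (2 * C * s)" using \<alpha> C s by (simp add: r_def powr_powr)
  have N1: "real N \<le> s * (b - a) / (2 * pi)"
    unfolding N_def using s ab(3) by (simp add: of_nat_floor)
  \<comment> \<open>By \<open>s1\<close> the quantity under the floor is at least 2, so rounding
    down loses at most half of it.\<close>
  have "s * (b - a) / (2 * pi) < real N + 1"
    unfolding N_def using s ab(3) by linarith
  moreover have "s * (b - a) / (4 * pi) \<ge> 1" using s1 by (simp add: field_simps)
  moreover have "s * (b - a) / (2 * pi) = 2 * (s * (b - a) / (4 * pi))" by simp
  ultimately have N2: "s * (b - a) / (4 * pi) \<le> real N" by linarith
  have k0: "(s * a - \<theta> - pi) / (2 * pi) \<le> of_int k0" "of_int k0 < (s * a - \<theta> - pi) / (2 * pi) + 1"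
    unfolding k0_def by linarith+
  then have k0': "s * a \<le> \<theta> + pi + 2 * pi * of_int k0" "\<theta> + pi + 2 * pi * of_int k0 < s * a + 2 * pi"
    by (auto simp: field_simps)
  have va: "a \<le> v k" for k
  proof -
    have "s * a \<le> \<theta> + pi + 2 * pi * of_int (k0 + int k)"
      using k0' by (simp add: algebra_simps) (smt (verit) mult_nonneg_nonneg of_nat_0_le_iff pi_gt_zero)
    then show ?thesis using s by (simp add: v_def field_simps)
  qed
  have vb: "v k \<le> b" if "k < N" for k
  proof -
    have "real k + 1 \<le> s * (b - a) / (2 * pi)" using that N1 by linarith
    then have "2 * pi * real k + 2 * pi \<le> s * b - s * a" by (simp add: field_simps)
    then have "\<theta> + pi + 2 * pi * of_int (k0 + int k) \<le> s * b"
      using k0' by (simp add: algebra_simps)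
    then show ?thesis using s by (simp add: v_def field_simps)
  qed
  have "\<exists>t. 0 \<le> t \<and> t \<le> 1 \<and> g t = v k" if "k < N" for k
    using IVT'[of g 0 "v k" 1] cont va[of k] vb[OF that] ab by auto
  then obtain T where T: "\<And>k. k < N \<Longrightarrow> 0 \<le> T k \<and> T k \<le> 1 \<and> g (T k) = v k" by metis
  \<comment> \<open>The interval of length \<open>r\<close> has the hitting time \<open>T k\<close>
    as an end point and extends towards the middle of the unit interval, so
    \<open>r \<le> 1 / 2\<close> keeps it inside.\<close>
  define l where "l k = (if T k \<ge> 1 / 2 then T k - r else T k)" for k
  define I where "I k = {l k..l k + r}" for k
  have I01: "I k \<subseteq> {0..1}" if "k < N" for k
    using T[OF that] r by (auto simp: I_def l_def)
  have near: "\<bar>s * g t - \<theta> - (pi + 2 * pi * of_int (k0 + int k))\<bar> \<le> pi / 2" if "k < N" "t \<in> I k" for k t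
  proof -
    have "\<bar>t - T k\<bar> \<le> r" using that r by (auto simp: I_def l_def split: if_splits)
    then have "\<bar>t - T k\<bar> powr \<alpha> \<le> r powr \<alpha>" using \<alpha> by (intro powr_mono2) auto
    then have "\<bar>g t - v k\<bar> \<le> C * r powr \<alpha>"
      using hoel[of t "T k"] I01[OF that(1)] that T[OF that(1)] C
      by (smt (verit, best) atLeastAtMost_iff mult_left_mono subset_iff)
    then have "s * \<bar>g t - v k\<bar> \<le> s * (C * r powr \<alpha>)" using s by (intro mult_left_mono) auto
    also have "\<dots> = pi / 2" using s C by (simp add: ralpha)
    finally have "\<bar>s * (g t - v k)\<bar> \<le> pi / 2" using s by (simp add: abs_mult)
    moreover have "s * (g t - v k) = s * g t - \<theta> - (pi + 2 * pi * of_int (k0 + int k))"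
      using s by (simp add: v_def field_simps)
    ultimately show ?thesis by simp
  qed
  have disj: "disjoint_family_on I {..<N}"
  unfolding disjoint_family_on_def
  proof (intro ballI impI)
    fix i j assume ij: "i \<in> {..<N}" "j \<in> {..<N}" "i \<noteq> j"
    show "I i \<inter> I j = {}"
    proof (rule ccontr)
      assume "I i \<inter> I j \<noteq> {}"
      then obtain t where t: "t \<in> I i" "t \<in> I j" by blast
      \<comment> \<open>At a common point the phase would be within \<open>pi / 2\<close> of two
        distinct odd multiples of \<open>pi\<close>, which are at least \<open>2 * pi\<close>
        apart.\<close>
      have "\<bar>2 * pi * of_int (k0 + int i) - 2 * pi * of_int (k0 + int j)\<bar> \<le> pi"
        using near[OF _ t(1)] near[OF _ t(2)] ij unfolding lessThan_iff by linarith
      then have "\<bar>2 * pi * (real i - real j)\<bar> \<le> pi" by (simp add: algebra_simps)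
      then have "2 * \<bar>real i - real j\<bar> \<le> 1" by (simp add: abs_mult)
      then have "\<bar>real i - real j\<bar> < 1" by simp
      moreover have "\<bar>real i - real j\<bar> \<ge> 1" using ij by linarith
      ultimately show False by simp
    qed
  qed
  have closed: "closed {t \<in> {0..1}. cos (s * g t - \<theta>) \<le> 0}"
    by (intro continuous_on_closed_Collect_le continuous_intros cont)
  have sub: "(\<Union>k\<in>{..<N}. I k) \<subseteq> {t \<in> {0..1}. cos (s * g t - \<theta>) \<le> 0}"
    using I01 cos_le_zero_near_odd_pi[OF near] by blast
  have "ennreal (s * (b - a) / (4 * pi) * r) \<le> ennreal (real N * r)"
    using N2 r by (intro ennreal_leI mult_right_mono) auto
  also have "\<dots> = (\<Sum>k<N. emeasure lborel (I k))"
    using r by (simp add: I_def ennreal_mult ennreal_of_nat_eq_real_of_nat)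
  also have "\<dots> = emeasure lborel (\<Union>k\<in>{..<N}. I k)"
    by (rule sum_emeasure[OF _ disj]) (auto simp: I_def)
  also have "\<dots> \<le> emeasure lborel {t \<in> {0..1}. cos (s * g t - \<theta>) \<le> 0}"
    using sub closed by (intro emeasure_mono) auto
  finally show ?thesis by (simp add: r_def)
qed

section \<open>Hoelder functions on Euclidean balls\<close>

lemma hoelder_imp_continuous_on:
  fixes h :: "'a::real_normed_vector \<Rightarrow> real"
  assumes \<alpha>: "0 < \<alpha>"
    and hoel: "\<And>x y. x \<in> S \<Longrightarrow> y \<in> S \<Longrightarrow> \<bar>h x - h y\<bar> \<le> C * norm (x - y) powr \<alpha>"
  shows "continuous_on S h"
  unfolding continuous_on_def
proof
  fix x assume x: "x \<in> S"
  have "((\<lambda>y. C * norm (y - x) powr \<alpha>) \<longlongrightarrow> C * norm (x - x) powr \<alpha>) (at x within S)"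
    using \<alpha> by (intro tendsto_intros tendsto_powr') auto
  then have "((\<lambda>y. C * norm (y - x) powr \<alpha>) \<longlongrightarrow> 0) (at x within S)" by simp
  then have "((\<lambda>y. h y - h x) \<longlongrightarrow> 0) (at x within S)"
    by (rule Lim_null_comparison[rotated]) (use hoel x in \<open>auto simp: eventually_at_filter\<close>)
  then show "(h \<longlongrightarrow> h x) (at x within S)" by (simp add: Lim_null[symmetric])
qed

lemma borel_Collect_le_open:
  fixes k :: "'a::topological_space \<Rightarrow> real"
  assumes "open S" "continuous_on S k"
  shows "{z \<in> S. k z \<le> 0} \<in> sets borel"
proof -
  have "open (k -` {0<..} \<inter> S)"
    using iffD1[OF continuous_on_open_vimage[OF assms(1)] assms(2)] by (elim allE[of _ "{0<..}"]) simp
  moreover have "{z \<in> S. k z \<le> 0} = S - (k -` {0<..} \<inter> S)" by auto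
  ultimately show ?thesis using assms by auto
qed

text \<open>Fubini over the translates of one segment on which \<open>h\<close> is not constant replaces a choice of
  adapted coordinates.\<close>

lemma oscillation_ball_aux:
  fixes h :: "'a::euclidean_space \<Rightarrow> real"
  assumes \<alpha>: "0 < \<alpha>" and C: "0 < C"
    and hoel: "\<And>x y. x \<in> ball u0 R \<Longrightarrow> y \<in> ball u0 R \<Longrightarrow> \<bar>h x - h y\<bar> \<le> C * norm (x - y) powr \<alpha>"
    and u: "u \<in> ball u0 R" and v: "v \<in> ball u0 R" and uv: "h u < h v"
  shows "\<exists>\<kappa>>0. \<exists>s0>0. \<forall>s\<ge>s0. \<forall>\<theta>.
    ennreal (\<kappa> * s powr (1 - 1 / \<alpha>)) \<le> emeasure lborel {z \<in> ball u0 R. cos (s * h z - \<theta>) \<le> 0}"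
proof -
  have cont: "continuous_on (ball u0 R) h" by (rule hoelder_imp_continuous_on[OF \<alpha> hoel])
  \<comment> \<open>With a third of the increment, moving both end points by less than
    \<open>e\<close> in value still leaves the common interval from \<open>a\<close> to
    \<open>b\<close>, of length \<open>e\<close>, between the two end values.\<close>
  define e where "e = (h v - h u) / 3"
  have e: "e > 0" using uv by (simp add: e_def)
  have near: "\<exists>\<rho>>0. \<forall>w\<in>ball 0 \<rho>. x + w \<in> ball u0 R \<and> \<bar>h (x + w) - h x\<bar> < e"
    if x: "x \<in> ball u0 R" for x
  proof -
    obtain r1 where r1: "r1 > 0" "ball x r1 \<subseteq> ball u0 R"
      using x open_ball open_contains_ball by metis
    obtain r2 where r2: "r2 > 0" "\<And>y. y \<in> ball u0 R \<Longrightarrow> dist y x < r2 \<Longrightarrow> dist (h y) (h x) < e"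
      using cont x e unfolding continuous_on_iff by metis
    show ?thesis
    proof (intro exI[of _ "min r1 r2"] conjI ballI)
      fix w :: 'a assume w: "w \<in> ball 0 (min r1 r2)"
      then have "x + w \<in> ball x r1" by (simp add: dist_norm)
      then show 1: "x + w \<in> ball u0 R" using r1 by blast
      show "\<bar>h (x + w) - h x\<bar> < e" using r2(2)[OF 1] w by (simp add: dist_norm)
    qed (use r1 r2 in auto)
  qed
  obtain \<rho>1 \<rho>2 where \<rho>1: "\<rho>1 > 0" "\<forall>w\<in>ball 0 \<rho>1. u + w \<in> ball u0 R \<and> \<bar>h (u + w) - h u\<bar> < e"
    and \<rho>2: "\<rho>2 > 0" "\<forall>w\<in>ball 0 \<rho>2. v + w \<in> ball u0 R \<and> \<bar>h (v + w) - h v\<bar> < e"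
    using near[OF u] near[OF v] by metis
  \<comment> \<open>For every \<open>w\<close> in \<open>ball 0 \<rho>\<close> the segment
    translated by \<open>w\<close> stays in the ball and \<open>h\<close> crosses all values from
    \<open>a\<close> to \<open>b\<close> along it.\<close>
  define \<rho> where "\<rho> = min \<rho>1 \<rho>2"
  have \<rho>: "\<rho> > 0" using \<rho>1 \<rho>2 by (simp add: \<rho>_def)
  define a b where "a = h u + e" and "b = h v - e"
  have ba: "b - a = e" by (simp add: a_def b_def e_def field_simps)
  \<comment> \<open>\<open>C'\<close> is the Hoelder constant of \<open>h\<close> along the segment
    parametrised by the unit interval; translation does not change it.\<close>
  define C' where "C' = C * norm (v - u) powr \<alpha>"
  have "u \<noteq> v" using uv by auto
  then have C': "C' > 0" using C by (simp add: C'_def)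
  define \<kappa>1 where "\<kappa>1 = e / (4 * pi) * (pi / (2 * C')) powr (1 / \<alpha>)"
  have \<kappa>1: "\<kappa>1 > 0" using e C' by (simp add: \<kappa>1_def)
  \<comment> \<open>The two terms of the maximum secure the two largeness conditions on
    \<open>s\<close> in \<open>oscillation_interval\<close>.\<close>
  define s0 where "s0 = max (4 * pi / e) (pi * 2 powr \<alpha> / (2 * C'))"
  have s0: "s0 > 0" using e by (simp add: s0_def less_max_iff_disj)
  define L where "L = measure lborel (ball (0::'a) \<rho>)"
  have L: "emeasure lborel (ball (0::'a) \<rho>) = ennreal L"
    unfolding L_def by (rule emeasure_eq_ennreal_measure) (use emeasure_lborel_ball_finite[of "0::'a" \<rho>] in auto)
  have "L > 0" unfolding L_def using \<rho> by (simp add: content_ball_pos)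
  have main: "ennreal (L * \<kappa>1 * s powr (1 - 1 / \<alpha>)) \<le> emeasure lborel {z \<in> ball u0 R. cos (s * h z - \<theta>) \<le> 0}"
    if s: "s \<ge> s0" for s \<theta>
  proof -
    define Q where "Q = {z \<in> ball u0 R. cos (s * h z - \<theta>) \<le> 0}"
    have Q[measurable]: "Q \<in> sets borel" unfolding Q_def
      by (intro borel_Collect_le_open continuous_intros cont) auto
    have spos: "s > 0" using s s0 by simp
    have seg: "ennreal (\<kappa>1 * s powr (1 - 1 / \<alpha>)) \<le> (\<integral>\<^sup>+t. indicator {0..1} t * indicator Q (u + t *\<^sub>R (v - u) + w) \<partial>lborel)"
      if w: "w \<in> ball 0 \<rho>" for w
    proof -
      define g where "g t = h (u + t *\<^sub>R (v - u) + w)" for t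
      have inb: "u + t *\<^sub>R (v - u) + w \<in> ball u0 R" if "t \<in> {0..1}" for t
      proof -
        have "u + w \<in> ball u0 R" "v + w \<in> ball u0 R" using \<rho>1 \<rho>2 w by (auto simp: \<rho>_def)
        then have "(1 - t) *\<^sub>R (u + w) + t *\<^sub>R (v + w) \<in> ball u0 R"
          using that by (intro convexD[OF convex_ball]) auto
        then show ?thesis by (simp add: algebra_simps)
      qed
      have hg: "\<bar>g t - g t'\<bar> \<le> C' * \<bar>t - t'\<bar> powr \<alpha>" if "t \<in> {0..1}" "t' \<in> {0..1}" for t t'
      proof -
        have "\<bar>g t - g t'\<bar> \<le> C * norm ((t - t') *\<^sub>R (v - u)) powr \<alpha>"
          unfolding g_def using hoel[OF inb[OF that(1)] inb[OF that(2)]] by (simp add: algebra_simps)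
        also have "\<dots> = C' * \<bar>t - t'\<bar> powr \<alpha>"
          by (simp add: C'_def powr_mult mult_ac)
        finally show ?thesis .
      qed
      have cg: "continuous_on {0..1} g"
        by (rule hoelder_imp_continuous_on[OF \<alpha>, of _ _ C']) (use hg in auto)
      have "\<bar>h (u + w) - h u\<bar> < e" "\<bar>h (v + w) - h v\<bar> < e"
        using \<rho>1(2) \<rho>2(2) w by (simp_all add: \<rho>_def)
      then have g0: "g 0 \<le> a" "b \<le> g 1" by (simp_all add: g_def a_def b_def)
      have s1: "4 * pi \<le> s * (b - a)"
        using s e unfolding ba s0_def by (simp add: field_simps)
      have "pi * 2 powr \<alpha> / (2 * C') \<le> s" using s by (simp add: s0_def)
      then have "pi / (2 * C' * s) \<le> (1 / 2) powr \<alpha>"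
        using C' spos by (simp add: field_simps powr_divide)
      then have "(pi / (2 * C' * s)) powr (1 / \<alpha>) \<le> ((1 / 2) powr \<alpha>) powr (1 / \<alpha>)"
        using \<alpha> C' spos by (intro powr_mono2) auto
      then have s2: "(pi / (2 * C' * s)) powr (1 / \<alpha>) \<le> 1 / 2"
        using \<alpha> by (simp add: powr_powr)
      have "(pi / (2 * C' * s)) powr (1 / \<alpha>) = (pi / (2 * C')) powr (1 / \<alpha>) * s powr (- 1 / \<alpha>)"
        using C' spos powr_divide[of "pi / (2 * C')" s "1 / \<alpha>"] by (simp add: powr_minus_divide)
      moreover have "s powr (1 - 1 / \<alpha>) = s * s powr (- 1 / \<alpha>)"
        using spos powr_add[of s 1 "- 1 / \<alpha>"] by simp
      ultimately have "\<kappa>1 * s powr (1 - 1 / \<alpha>) = s * (b - a) / (4 * pi) * (pi / (2 * C' * s)) powr (1 / \<alpha>)"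
        unfolding ba by (simp add: \<kappa>1_def)
      also have "ennreal \<dots> \<le> emeasure lborel {t \<in> {0..1}. cos (s * g t - \<theta>) \<le> 0}"
        using oscillation_interval[OF \<alpha> C' spos cg hg g0 _ s1 s2] e ba by simp
      also have "{t \<in> {0..1}. cos (s * g t - \<theta>) \<le> 0} = {t \<in> {0..1}. u + t *\<^sub>R (v - u) + w \<in> Q}"
        using inb by (auto simp: Q_def g_def)
      also have "emeasure lborel \<dots> = (\<integral>\<^sup>+t. indicator {t \<in> {0..1}. u + t *\<^sub>R (v - u) + w \<in> Q} t \<partial>lborel)"
        by (rule nn_integral_indicator[symmetric]) measurable
      also have "\<dots> = (\<integral>\<^sup>+t. indicator {0..1} t * indicator Q (u + t *\<^sub>R (v - u) + w) \<partial>lborel)"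
        by (intro nn_integral_cong) (auto simp: indicator_def)
      finally show ?thesis .
    qed
    have ma: "(\<lambda>x. u + snd x *\<^sub>R (v - u) + fst x) \<in> borel_measurable (lborel \<Otimes>\<^sub>M (lborel :: real measure))"
      by (intro borel_measurable_add borel_measurable_scaleR borel_measurable_const measurable_fst'' measurable_snd'') auto
    have mb: "(snd :: 'a \<times> real \<Rightarrow> real) \<in> borel_measurable (lborel \<Otimes>\<^sub>M lborel)"
      by (simp add: measurable_snd'')
    have meas: "(\<lambda>(w, t). indicator {0..1} t * indicator Q (u + t *\<^sub>R (v - u) + w) :: ennreal)
      \<in> borel_measurable (lborel \<Otimes>\<^sub>M lborel)" unfolding case_prod_unfold
      by (intro borel_measurable_times_ennreal measurable_compose[OF mb borel_measurable_indicator]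
          measurable_compose[OF ma borel_measurable_indicator[OF Q]]) simp
    have "ennreal (L * \<kappa>1 * s powr (1 - 1 / \<alpha>)) = (\<integral>\<^sup>+w. indicator (ball 0 \<rho>) w * ennreal (\<kappa>1 * s powr (1 - 1 / \<alpha>)) \<partial>(lborel :: 'a measure))"
      using \<open>L > 0\<close> \<kappa>1 by (subst nn_integral_multc) (auto simp: L ennreal_mult mult.assoc intro!: borel_measurable_indicator)
    \<comment> \<open>The segment estimate holds for \<open>w\<close> in the small ball, and letting
      \<open>w\<close> range over the whole space only increases the right side. After the exchange
      of integrals, the inner integral for fixed \<open>t\<close> is that of a translate of
      \<open>Q\<close>, hence the measure of \<open>Q\<close>.\<close>
    also have "\<dots> \<le> (\<integral>\<^sup>+w. \<integral>\<^sup>+t. indicator {0..1} t * indicator Q (u + t *\<^sub>R (v - u) + w) \<partial>lborel \<partial>lborel)"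
      using seg by (intro nn_integral_mono) (auto simp: indicator_def)
    also have "\<dots> = (\<integral>\<^sup>+t. \<integral>\<^sup>+w. indicator {0..1} t * indicator Q (u + t *\<^sub>R (v - u) + w) \<partial>lborel \<partial>lborel)"
      by (rule lborel_pair.Fubini'[symmetric]) (rule meas)
    also have "\<dots> = (\<integral>\<^sup>+t. indicator {0..1} t * emeasure lborel Q \<partial>(lborel::real measure))"
    proof (rule nn_integral_cong)
      fix t :: real
      have "(\<integral>\<^sup>+w. indicator {0..1} t * indicator Q (u + t *\<^sub>R (v - u) + w) \<partial>(lborel::'a measure))
        = indicator {0..1} t * (\<integral>\<^sup>+w. indicator Q ((u + t *\<^sub>R (v - u)) + w) \<partial>(lborel::'a measure))"
        by (rule nn_integral_cmult) measurable
      also have "(\<integral>\<^sup>+w. indicator Q ((u + t *\<^sub>R (v - u)) + w) \<partial>(lborel::'a measure))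
        = (\<integral>\<^sup>+w. indicator Q w \<partial>distr lborel borel ((+) (u + t *\<^sub>R (v - u))))"
        by (subst nn_integral_distr) auto
      also have "\<dots> = emeasure lborel Q" by (simp add: lborel_distr_plus)
      finally show "(\<integral>\<^sup>+w. indicator {0..1} t * indicator Q (u + t *\<^sub>R (v - u) + w) \<partial>(lborel::'a measure))
        = indicator {0..1} t * emeasure lborel Q" .
    qed
    also have "\<dots> = emeasure lborel Q"
      by (subst nn_integral_multc) auto
    finally show ?thesis by (simp add: Q_def)
  qed
  have "L * \<kappa>1 > 0" using \<open>L > 0\<close> \<kappa>1 by simp
  with main s0 show ?thesis by blast
qed

text \<open>Enlarging \<open>C\<close> makes it positive, and exchanging \<open>u\<close> and
  \<open>v\<close> if necessary puts the smaller value first.\<close>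

lemma oscillation_ball:
  fixes h :: "'a::euclidean_space \<Rightarrow> real"
  assumes \<alpha>: "0 < \<alpha>"
    and hoel: "\<And>x y. x \<in> ball u0 R \<Longrightarrow> y \<in> ball u0 R \<Longrightarrow> \<bar>h x - h y\<bar> \<le> C * norm (x - y) powr \<alpha>"
    and u: "u \<in> ball u0 R" and v: "v \<in> ball u0 R" and uv: "h u \<noteq> h v"
  shows "\<exists>\<kappa>>0. \<exists>s0>0. \<forall>s\<ge>s0. \<forall>\<theta>.
    ennreal (\<kappa> * s powr (1 - 1 / \<alpha>)) \<le> emeasure lborel {z \<in> ball u0 R. cos (s * h z - \<theta>) \<le> 0}"
proof -
  have hoel': "\<bar>h x - h y\<bar> \<le> max C 1 * norm (x - y) powr \<alpha>" if "x \<in> ball u0 R" "y \<in> ball u0 R" for x y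
    by (rule order_trans[OF hoel[OF that] mult_right_mono]) simp_all
  have C1: "0 < max C 1" by simp
  show ?thesis
  proof (cases "h u < h v")
    case True
    show ?thesis by (rule oscillation_ball_aux[where C = "max C 1" and u = u and v = v])
      (fact \<alpha> C1 hoel' u v True)+
  next
    case False
    then have vu: "h v < h u" using uv by simp
    show ?thesis by (rule oscillation_ball_aux[where C = "max C 1" and u = v and v = u])
      (fact \<alpha> C1 hoel' v u vu)+
  qed
qed

subsection \<open>Charts and the Riemannian distance\<close>

text \<open>The segment from the identity to \<open>A\<close> consists of matrices with positive
  quadratic form, hence of invertible ones. The determinant is continuous along it and starts at 1,
  so it cannot reach a nonpositive value without vanishing on the way.\<close>

lemma det_pos_if_pos_def:
  fixes A :: "real^'n^'n"
  assumes pd: "\<And>v. v \<noteq> 0 \<Longrightarrow> v \<bullet> (A *v v) > 0"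
  shows "det A > 0"
proof (rule ccontr)
  assume "\<not> det A > 0"
  define P where "P t = (1 - t) *\<^sub>R mat 1 + t *\<^sub>R A" for t :: real
  have "continuous_on {0..1} (\<lambda>t. det (P t))"
    unfolding det_def P_def by (intro continuous_intros)
  moreover have "det (P 1) \<le> 0" "det (P 0) \<ge> 0" using \<open>\<not> det A > 0\<close> by (simp_all add: P_def)
  ultimately obtain t where t: "0 \<le> t" "t \<le> 1" "det (P t) = 0"
    using IVT2'[of "\<lambda>t. det (P t)" 1 0 0] by auto
  then have "\<not> invertible (P t)" by (simp add: invertible_det_nz)
  then obtain v where v: "P t *v v = 0" "v \<noteq> 0"
    by (auto simp: invertible_left_inverse matrix_left_invertible_ker)
  have "0 = v \<bullet> (P t *v v)" using v by simp
  also have "\<dots> = (1 - t) * (v \<bullet> v) + t * (v \<bullet> (A *v v))"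
    by (simp add: P_def matrix_vector_mult_add_rdistrib scaleR_matrix_vector_assoc[symmetric] inner_add_right)
  also have "\<dots> > 0"
  proof (cases "t = 0")
    case False
    then show ?thesis using t pd[OF v(2)] by (intro add_nonneg_pos) auto
  qed (use v in auto)
  finally show False by simp
qed

text \<open>The operator norm is at most the sum of the absolute values of the entries, which is
  continuous and so bounded on \<open>K\<close>.\<close>

lemma continuous_on_matrix_bound:
  fixes G :: "'a::topological_space \<Rightarrow> real^'n^'n"
  assumes "compact K" "continuous_on K G"
  shows "\<exists>L\<ge>0. \<forall>z\<in>K. \<forall>w. w \<bullet> (G z *v w) \<le> L * (norm w)\<^sup>2"
proof -
  define S where "S z = (\<Sum>i\<in>UNIV. \<Sum>j\<in>UNIV. \<bar>G z $ i $ j\<bar>)" for z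
  have "continuous_on K S" unfolding S_def by (intro continuous_intros assms)
  then have "bounded (S ` K)" using assms(1) compact_continuous_image compact_imp_bounded by blast
  then obtain L where L: "\<And>z. z \<in> K \<Longrightarrow> \<bar>S z\<bar> \<le> L" unfolding bounded_iff by auto
  show ?thesis
  proof (intro exI[of _ "max L 0"] conjI ballI allI)
    fix z w assume z: "z \<in> K"
    have "w \<bullet> (G z *v w) \<le> norm w * norm (G z *v w)" by (rule norm_cauchy_schwarz)
    also have "norm (G z *v w) \<le> onorm ((*v) (G z)) * norm w" by (rule onorm) simp
    also have "onorm ((*v) (G z)) \<le> S z" unfolding S_def by (rule onorm_le_matrix_component_sum)
    also have "S z \<le> max L 0" using L[OF z] by simp
    finally show "w \<bullet> (G z *v w) \<le> max L 0 * (norm w)\<^sup>2"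
      by (simp add: mult_right_mono mult_left_mono power2_eq_square algebra_simps)
  qed simp
qed

lemma smooth_on_imp_continuous_on: "smooth_on S f \<Longrightarrow> continuous_on S f"
  unfolding smooth_on_def by (metis Ck_on.simps(1))

lemma smooth_on_imp_differentiable: "smooth_on S f \<Longrightarrow> u \<in> S \<Longrightarrow> f differentiable (at u)"
  unfolding smooth_on_def by (metis Ck_on.simps(2))

lemma smooth_on_imp_continuous_derivative:
  "smooth_on S f \<Longrightarrow> continuous_on S (\<lambda>u. frechet_derivative f (at u) v)"
  unfolding smooth_on_def by (metis Ck_on.simps)

text \<open>This turns images under an inverse chart into preimages under the chart, so that
  openness and Borel measurability follow from continuity.\<close>

lemma homeomorphism_image_eq:
  assumes "homeomorphism U V \<phi> \<psi>" "W \<subseteq> V"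
  shows "\<psi> ` W = {x \<in> U. \<phi> x \<in> W}"
  using assms unfolding homeomorphism_def by (auto simp: image_iff) (metis image_eqI subsetD)+

section \<open>Charts of a fixed Riemannian manifold\<close>

context
  fixes A :: "('x::{t2_space,second_countable_topology}, 'n::finite) chart set"
    and G :: "('x, 'n) chart \<Rightarrow> real^'n \<Rightarrow> real^'n^'n"
  assumes manifold: "riemannian_manifold A G"
begin

abbreviation (input) chart_inv :: "('x, 'n) chart \<Rightarrow> real^'n \<Rightarrow> 'x" where
  "chart_inv c \<equiv> inv_into (fst c) (snd c)"

lemma chart_homeomorphism:
  assumes "c \<in> A"
  shows "open (fst c)" "open (snd c ` fst c)"
    "homeomorphism (fst c) (snd c ` fst c) (snd c) (chart_inv c)"
  using manifold assms unfolding riemannian_manifold_def smooth_atlas_def is_chart_def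
  by (auto simp: case_prod_unfold)

lemma chart_inv_image:
  assumes "c \<in> A" "z \<in> snd c ` fst c"
  shows "chart_inv c z \<in> fst c" "snd c (chart_inv c z) = z"
  using chart_homeomorphism(3)[OF assms(1)] assms(2) unfolding homeomorphism_def by auto

lemma chart_inv_chart:
  assumes "c \<in> A" "x \<in> fst c"
  shows "chart_inv c (snd c x) = x"
  using chart_homeomorphism(3)[OF assms(1)] assms(2) unfolding homeomorphism_def by auto

lemma continuous_on_chart_inv:
  assumes "c \<in> A"
  shows "continuous_on (snd c ` fst c) (chart_inv c)"
  using chart_homeomorphism(3)[OF assms] unfolding homeomorphism_def by auto

lemma continuous_on_chart:
  assumes "c \<in> A"
  shows "continuous_on (fst c) (snd c)"
  using chart_homeomorphism(3)[OF assms] unfolding homeomorphism_def by auto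

lemma smooth_transition:
  assumes "c \<in> A" "d \<in> A"
  shows "smooth_on (snd c ` (fst c \<inter> fst d)) (snd d \<circ> chart_inv c)"
proof -
  have "smooth_on (snd c ` (fst c \<inter> fst d)) (transition c d)"
    using manifold assms unfolding riemannian_manifold_def smooth_atlas_def by blast
  then show ?thesis by (simp add: transition_def case_prod_unfold)
qed

text \<open>This is the tensor law of the metric read as an equality of quadratic forms: the length
  of a tangent vector is the same in all charts around its base point.\<close>

lemma metric_transformation:
  assumes "c \<in> A" "d \<in> A" "x \<in> fst c" "x \<in> fst d"
    and "J = frechet_derivative (snd d \<circ> chart_inv c) (at (snd c x))"
  shows "J v \<bullet> (G d (snd d x) *v J v) = v \<bullet> (G c (snd c x) *v v)"
proof -
  have "(snd d \<circ> chart_inv c) differentiable (at (snd c x))"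
    using smooth_on_imp_differentiable[OF smooth_transition[OF assms(1,2)]] assms by auto
  then have "linear J" unfolding assms(5) using linear_frechet_derivative by blast
  then have J: "J v = matrix J *v v" by simp
  have "J = frechet_derivative (transition c d) (at (snd c x))"
    by (simp add: assms(5) transition_def case_prod_unfold)
  moreover have "\<forall>c\<in>A. \<forall>d\<in>A. \<forall>x\<in>fst c \<inter> fst d.
      G c (snd c x) = transpose (matrix (frechet_derivative (transition c d) (at (snd c x))))
        ** G d (snd d x) ** matrix (frechet_derivative (transition c d) (at (snd c x)))"
    using manifold unfolding riemannian_manifold_def riemannian_metric_def Let_def by (elim conjE)
  ultimately have "G c (snd c x) = transpose (matrix J) ** G d (snd d x) ** matrix J"
    using assms(1-4) by (metis IntI)
  then have "G c (snd c x) *v v = transpose (matrix J) *v (G d (snd d x) *v (matrix J *v v))"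
    by (simp add: matrix_vector_mul_assoc matrix_mul_assoc del: transpose_matrix_vector)
  then have "v \<bullet> (G c (snd c x) *v v) = ((G d (snd d x) *v J v) v* matrix J) \<bullet> v"
    by (simp add: J inner_commute)
  also have "\<dots> = (G d (snd d x) *v J v) \<bullet> J v" by (simp only: dot_lmul_matrix J)
  finally show ?thesis by (simp add: inner_commute)
qed

text \<open>Both the regularity of a curve and its speed are tested in charts \<open>d\<close> other
  than the one in which it is a segment. There its velocity is given by the chain rule through the
  transition map.\<close>

lemma chart_segment_has_vector_derivative:
  assumes "c \<in> A" "d \<in> A" "z \<in> snd c ` fst c" "chart_inv c z \<in> fst d" "z = u + t *\<^sub>R w"
  shows "((snd d \<circ> (\<lambda>t. chart_inv c (u + t *\<^sub>R w))) has_vector_derivative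
    frechet_derivative (snd d \<circ> chart_inv c) (at z) w) (at t)"
proof -
  have "z \<in> snd c ` (fst c \<inter> fst d)"
    using chart_inv_image[OF assms(1,3)] assms(4) by (metis IntI image_eqI)
  then have "((snd d \<circ> chart_inv c) has_derivative frechet_derivative (snd d \<circ> chart_inv c) (at z)) (at z)"
    using smooth_on_imp_differentiable[OF smooth_transition[OF assms(1,2)]] frechet_derivative_works by blast
  moreover have "((\<lambda>t. u + t *\<^sub>R w) has_vector_derivative w) (at t)"
    by (auto intro!: derivative_eq_intros)
  ultimately have "((snd d \<circ> chart_inv c) \<circ> (\<lambda>t. u + t *\<^sub>R w) has_vector_derivative
      frechet_derivative (snd d \<circ> chart_inv c) (at z) w) (at t)"
    unfolding assms(5)
    by (rule vector_derivative_diff_chain_within[rotated, OF has_derivative_at_withinI])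
  then show ?thesis by (simp add: o_def)
qed

lemma chart_image_open:
  assumes "c \<in> A" "open W" "W \<subseteq> snd c ` fst c"
  shows "open (chart_inv c ` W)"
proof -
  have "chart_inv c ` W = snd c -` W \<inter> fst c"
    using homeomorphism_image_eq[OF chart_homeomorphism(3)[OF assms(1)] assms(3)] by auto
  also have "open \<dots>"
    using continuous_on_open_vimage chart_homeomorphism(1)[OF assms(1)] continuous_on_chart[OF assms(1)] assms(2)
    by fast
  finally show ?thesis .
qed

text \<open>The straight coordinate segment competes in the infimum that defines the distance. Its
  speed is at most \<open>sqrt \<Lambda>\<close> times the Euclidean length, because the metric
  coefficients are bounded on the compact ball.\<close>

lemma riemannian_dist_le_chart:
  assumes c: "c \<in> A" and sub: "cball u0 R \<subseteq> snd c ` fst c"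
  shows "\<exists>L\<ge>0. \<forall>u\<in>ball u0 R. \<forall>v\<in>ball u0 R.
    riemannian_dist A G (chart_inv c u) (chart_inv c v) \<le> L * norm (u - v)"
proof -
  have "continuous_on (snd c ` fst c) (G c)"
    using manifold c smooth_on_imp_continuous_on
    unfolding riemannian_manifold_def riemannian_metric_def by blast
  then have "continuous_on (cball u0 R) (G c)" using sub continuous_on_subset by blast
  then obtain \<Lambda> where \<Lambda>: "\<Lambda> \<ge> 0" "\<And>z w. z \<in> cball u0 R \<Longrightarrow> w \<bullet> (G c z *v w) \<le> \<Lambda> * (norm w)\<^sup>2"
    using continuous_on_matrix_bound[OF compact_cball] by metis
  have "riemannian_dist A G (chart_inv c u) (chart_inv c v) \<le> sqrt \<Lambda> * norm (u - v)"
    if u: "u \<in> ball u0 R" and v: "v \<in> ball u0 R" for u v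
  proof -
    define z where "z t = u + t *\<^sub>R (v - u)" for t :: real
    define \<gamma> where "\<gamma> t = chart_inv c (z t)" for t
    have z_ball: "z t \<in> ball u0 R" if "t \<in> {0..1}" for t
    proof -
      have "(1 - t) *\<^sub>R u + t *\<^sub>R v \<in> ball u0 R"
        using that u v by (intro convexD[OF convex_ball]) auto
      then show ?thesis by (simp add: algebra_simps z_def)
    qed
    then have z_mem: "z t \<in> snd c ` fst c" if "t \<in> {0..1}" for t
      using that sub ball_subset_cball by blast
    have deriv: "((snd d \<circ> \<gamma>) has_vector_derivative
        frechet_derivative (snd d \<circ> chart_inv c) (at (z t)) (v - u)) (at t)"
      if "d \<in> A" "t \<in> {0..1}" "\<gamma> t \<in> fst d" for d t
      using chart_segment_has_vector_derivative[OF c that(1) z_mem[OF that(2)], of u t "v - u"] that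
      unfolding \<gamma>_def z_def by blast
    have cz: "continuous_on T z" for T unfolding z_def by (intro continuous_intros)
    have "continuous_on {0..1} \<gamma>"
      unfolding \<gamma>_def using z_mem
      by (intro continuous_on_compose2[OF continuous_on_chart_inv[OF c] cz]) auto
    then have "path \<gamma>" by (simp add: path_def)
    have "piecewise_C1_curve A \<gamma>"
      unfolding piecewise_C1_curve_def
    proof (intro conjI ballI allI impI)
      fix d a b assume d: "d \<in> A" and ab: "0 \<le> a \<and> a < b \<and> b \<le> 1 \<and> \<gamma> ` {a..b} \<subseteq> fst d"
      have zW: "z ` {a..b} \<subseteq> snd c ` (fst c \<inter> fst d)"
      proof
        fix y assume "y \<in> z ` {a..b}"
        then obtain t where t: "t \<in> {a..b}" "y = z t" by auto
        then have "\<gamma> t \<in> fst c \<inter> fst d" "snd c (\<gamma> t) = z t"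
          using ab chart_inv_image[OF c z_mem[of t]] by (auto simp: \<gamma>_def)
        then show "y \<in> snd c ` (fst c \<inter> fst d)" using t by (metis image_eqI)
      qed
      have "(snd d \<circ> \<gamma>) C1_differentiable_on {a..b}"
        unfolding C1_differentiable_on_def
      proof (intro exI conjI ballI)
        fix t assume "t \<in> {a..b}"
        then show "((snd d \<circ> \<gamma>) has_vector_derivative
            (\<lambda>t. frechet_derivative (snd d \<circ> chart_inv c) (at (z t)) (v - u)) t) (at t)"
          using ab d by (intro deriv) auto
      next
        show "continuous_on {a..b} (\<lambda>t. frechet_derivative (snd d \<circ> chart_inv c) (at (z t)) (v - u))"
          by (rule continuous_on_compose2[OF smooth_on_imp_continuous_derivative[OF smooth_transition[OF c d]] cz zW])
      qed
      then show "(snd d \<circ> \<gamma>) piecewise_C1_differentiable_on {a..b}"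
        by (rule C1_differentiable_imp_piecewise)
    qed (fact \<open>path \<gamma>\<close>)
    moreover have "pathstart \<gamma> = chart_inv c u" "pathfinish \<gamma> = chart_inv c v"
      by (simp_all add: pathstart_def pathfinish_def \<gamma>_def z_def)
    moreover have "riemannian_length A G \<gamma> \<le> ennreal (sqrt \<Lambda> * norm (u - v))"
    proof -
      have speed: "riemannian_speed A G \<gamma> t \<le> sqrt \<Lambda> * norm (u - v)" if t: "t \<in> {0..1}" for t
      proof -
        \<comment> \<open>The speed is defined through a chart picked by \<open>SOME\<close>, about
          which only membership is known; \<open>metric_transformation\<close> moves the computation
          back to \<open>c\<close>.\<close>
        define d where "d = (SOME d. d \<in> A \<and> \<gamma> t \<in> fst d)"
        have "\<exists>d. d \<in> A \<and> \<gamma> t \<in> fst d"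
          using chart_inv_image(1)[OF c z_mem[OF t]] c unfolding \<gamma>_def by blast
        then have d: "d \<in> A" "\<gamma> t \<in> fst d" unfolding d_def by (metis (mono_tags, lifting) someI_ex)+
        define J where "J = frechet_derivative (snd d \<circ> chart_inv c) (at (z t))"
        have zt: "snd c (\<gamma> t) = z t" "\<gamma> t \<in> fst c"
          using chart_inv_image[OF c z_mem[OF t]] by (auto simp: \<gamma>_def)
        have "vector_derivative (snd d \<circ> \<gamma>) (at t) = J (v - u)"
          unfolding J_def by (rule vector_derivative_at[OF deriv[OF d(1) t d(2)]])
        then have "riemannian_speed A G \<gamma> t = sqrt (J (v - u) \<bullet> (G d (snd d (\<gamma> t)) *v J (v - u)))"
          by (simp add: riemannian_speed_def Let_def d_def)
        also have "\<dots> = sqrt ((v - u) \<bullet> (G c (z t) *v (v - u)))"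
          using metric_transformation[OF c d(1) zt(2) d(2) _, of J "v - u"] zt(1) by (simp add: J_def)
        also have "\<dots> \<le> sqrt (\<Lambda> * (norm (v - u))\<^sup>2)"
          using \<Lambda>(2)[of "z t" "v - u"] z_ball[OF t] by auto
        finally show ?thesis by (simp add: real_sqrt_mult norm_minus_commute)
      qed
      have "riemannian_length A G \<gamma> \<le> (\<integral>\<^sup>+t\<in>{0..1}. ennreal (sqrt \<Lambda> * norm (u - v)) \<partial>(lborel :: real measure))"
        unfolding riemannian_length_def
        by (rule nn_integral_mono) (use speed in \<open>auto simp: indicator_def intro!: ennreal_leI\<close>)
      then show ?thesis by (simp add: nn_integral_cmult)
    qed
    ultimately have "(INF \<gamma> \<in> {\<gamma>. piecewise_C1_curve A \<gamma> \<and> pathstart \<gamma> = chart_inv c u \<and>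
        pathfinish \<gamma> = chart_inv c v}. riemannian_length A G \<gamma>) \<le> ennreal (sqrt \<Lambda> * norm (u - v))"
      by (intro INF_lower2[of \<gamma>]) auto
    then show ?thesis
      unfolding riemannian_dist_def using \<Lambda>(1) by (intro enn2real_leI) auto
  qed
  then show ?thesis using \<Lambda>(1) by (intro exI[of _ "sqrt \<Lambda>"]) auto
qed

text \<open>The density \<open>sqrt (det (G c z))\<close> is continuous and positive, so it has a
  positive lower bound \<open>g0\<close> on the compact ball.\<close>

lemma volume_ge_lebesgue_chart:
  assumes vol: "is_riemannian_volume A G vol" and c: "c \<in> A"
    and sub: "cball u0 R \<subseteq> snd c ` fst c"
  shows "\<exists>g0>0. \<forall>Q\<in>sets borel. Q \<subseteq> ball u0 R \<longrightarrow>
    ennreal g0 * emeasure lborel Q \<le> emeasure vol (chart_inv c ` Q) \<and> chart_inv c ` Q \<in> sets borel"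
proof -
  have G: "continuous_on (snd c ` fst c) (G c)"
    "\<And>u v. u \<in> snd c ` fst c \<Longrightarrow> v \<noteq> 0 \<Longrightarrow> v \<bullet> (G c u *v v) > 0"
    using manifold c smooth_on_imp_continuous_on
    unfolding riemannian_manifold_def riemannian_metric_def by blast+
  have cont: "continuous_on (cball u0 R) (\<lambda>z. sqrt (det (G c z)))"
    unfolding det_def using continuous_on_subset[OF G(1) sub] by (intro continuous_intros)
  \<comment> \<open>The minimum over the compact ball is attained and positive, by positive
    definiteness at the minimiser. For negative \<open>R\<close> the ball is empty and any positive
    constant serves.\<close>
  have "\<exists>g0>0. \<forall>z\<in>cball u0 R. g0 \<le> sqrt (det (G c z))"
  proof (cases "cball u0 R = {}")
    case False
    obtain z0 where "z0 \<in> cball u0 R" "\<And>z. z \<in> cball u0 R \<Longrightarrow> sqrt (det (G c z0)) \<le> sqrt (det (G c z))"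
      using continuous_attains_inf[OF compact_cball False cont] by blast
    moreover from this have "det (G c z0) > 0"
      using G(2) sub by (intro det_pos_if_pos_def) blast
    ultimately show ?thesis by (intro exI[of _ "sqrt (det (G c z0))"]) auto
  qed (auto intro: exI[of _ 1])
  then obtain g0 where g0: "g0 > 0" "\<And>z. z \<in> cball u0 R \<Longrightarrow> g0 \<le> sqrt (det (G c z))" by blast
  have "ennreal g0 * emeasure lborel Q \<le> emeasure vol (chart_inv c ` Q) \<and> chart_inv c ` Q \<in> sets borel"
    if Q: "Q \<in> sets borel" "Q \<subseteq> ball u0 R" for Q
  proof -
    have QU: "Q \<subseteq> snd c ` fst c" using Q(2) sub ball_subset_cball by blast
    have eq: "chart_inv c ` Q = snd c -` Q \<inter> space (restrict_space borel (fst c))"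
      using homeomorphism_image_eq[OF chart_homeomorphism(3)[OF c] QU] by (auto simp: space_restrict_space)
    have "snd c \<in> borel_measurable (restrict_space borel (fst c))"
      by (rule borel_measurable_continuous_on_restrict[OF continuous_on_chart[OF c]])
    from measurable_sets[OF this Q(1)] have "chart_inv c ` Q \<in> sets (restrict_space borel (fst c))"
      unfolding eq .
    then have B: "chart_inv c ` Q \<in> sets borel"
      using chart_homeomorphism(1)[OF c] by (subst (asm) sets_restrict_space_iff) auto
    have B': "chart_inv c ` Q \<subseteq> fst c" unfolding eq by (auto simp: space_restrict_space)
    have im: "snd c ` chart_inv c ` Q = Q"
      using chart_inv_image(2)[OF c] QU by (force simp: image_image)
    have "ennreal g0 * emeasure lborel Q = (\<integral>\<^sup>+u\<in>Q. ennreal g0 \<partial>lborel)"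
      using Q(1) by (simp add: nn_integral_cmult)
    also have "\<dots> \<le> (\<integral>\<^sup>+u\<in>Q. ennreal (sqrt (det (G c u))) \<partial>lborel)"
      by (rule nn_integral_mono) (use g0(2) Q(2) ball_subset_cball in \<open>fastforce simp: indicator_def intro!: ennreal_leI\<close>)
    also have "\<dots> = emeasure vol (chart_inv c ` Q)"
      using vol c B B' unfolding is_riemannian_volume_def by (simp add: im)
    finally show ?thesis using B by simp
  qed
  then show ?thesis using g0(1) by blast
qed

text \<open>The Riemannian distance is at most a multiple of the Euclidean one in coordinates, so
  Hoelder continuity passes to the coordinate expression with the same exponent.\<close>

lemma hoelder_chart:
  assumes \<alpha>: "0 < \<alpha>" and hoel: "hoelder_continuous (riemannian_dist A G) \<alpha> f"
    and c: "c \<in> A" and sub: "cball u0 R \<subseteq> snd c ` fst c"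
  shows "\<exists>C. \<forall>u\<in>ball u0 R. \<forall>v\<in>ball u0 R.
    \<bar>f (chart_inv c u) - f (chart_inv c v)\<bar> \<le> C * norm (u - v) powr \<alpha>"
proof -
  obtain C where C: "\<And>x y. \<bar>f x - f y\<bar> \<le> C * riemannian_dist A G x y powr \<alpha>"
    using hoel unfolding hoelder_continuous_def by blast
  obtain L where L: "L \<ge> 0" "\<And>u v. u \<in> ball u0 R \<Longrightarrow> v \<in> ball u0 R \<Longrightarrow>
      riemannian_dist A G (chart_inv c u) (chart_inv c v) \<le> L * norm (u - v)"
    using riemannian_dist_le_chart[OF c sub] by blast
  have "\<bar>f (chart_inv c u) - f (chart_inv c v)\<bar> \<le> (max C 0 * L powr \<alpha>) * norm (u - v) powr \<alpha>"
    if "u \<in> ball u0 R" "v \<in> ball u0 R" for u v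
  proof -
    let ?d = "riemannian_dist A G (chart_inv c u) (chart_inv c v)"
    have "\<bar>f (chart_inv c u) - f (chart_inv c v)\<bar> \<le> C * ?d powr \<alpha>" by (rule C)
    \<comment> \<open>The Hoelder constant carries no sign condition; the monotonicity step that
      follows needs a nonnegative factor.\<close>
    also have "\<dots> \<le> max C 0 * ?d powr \<alpha>" by (intro mult_right_mono) auto
    also have "\<dots> \<le> max C 0 * (L * norm (u - v)) powr \<alpha>"
      using L(2)[OF that] \<alpha> by (intro mult_left_mono powr_mono2) (auto simp: riemannian_dist_def)
    finally show ?thesis using L(1) by (simp add: powr_mult mult.assoc)
  qed
  then show ?thesis by blast
qed

lemma chart_ball_exists:
  "\<exists>c\<in>A. \<exists>R>0. x \<in> fst c \<and> cball (snd c x) R \<subseteq> snd c ` fst c"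
proof -
  have "(\<Union>c\<in>A. fst c) = UNIV"
    using manifold unfolding riemannian_manifold_def smooth_atlas_def by (elim conjE)
  then obtain c where c: "c \<in> A" "x \<in> fst c" by blast
  then show ?thesis
    using open_contains_cball_eq[OF chart_homeomorphism(2)[OF c(1)]] by blast
qed

text \<open>Continuity refers to the given topology, while the hypothesis speaks of the Riemannian
  distance. Charts mediate: the coordinate expression is Hoelder for the Euclidean norm, and charts
  are homeomorphisms.\<close>

lemma hoelder_imp_continuous:
  assumes \<alpha>: "0 < \<alpha>" and hoel: "hoelder_continuous (riemannian_dist A G) \<alpha> f"
  shows "continuous_on UNIV f"
proof (rule continuous_at_imp_continuous_on, rule ballI)
  fix x
  obtain c R where c: "c \<in> A" "R > 0" "x \<in> fst c" "cball (snd c x) R \<subseteq> snd c ` fst c"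
    using chart_ball_exists by blast
  define W where "W = ball (snd c x) R"
  have WU: "W \<subseteq> snd c ` fst c" using c(4) ball_subset_cball unfolding W_def by blast
  have W: "open (chart_inv c ` W)" by (rule chart_image_open[OF c(1) _ WU]) (simp add: W_def)
  obtain C where C: "\<And>u v. u \<in> W \<Longrightarrow> v \<in> W \<Longrightarrow>
      \<bar>(f \<circ> chart_inv c) u - (f \<circ> chart_inv c) v\<bar> \<le> C * norm (u - v) powr \<alpha>"
    using hoelder_chart[OF \<alpha> hoel c(1,4)] unfolding W_def comp_def by blast
  have sub: "chart_inv c ` W \<subseteq> fst c" using chart_inv_image(1)[OF c(1)] WU by blast
  have "continuous_on W (f \<circ> chart_inv c)" by (rule hoelder_imp_continuous_on[OF \<alpha> C])
  moreover have "continuous_on (chart_inv c ` W) (snd c)"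
    by (rule continuous_on_subset[OF continuous_on_chart[OF c(1)] sub])
  moreover have "snd c ` chart_inv c ` W \<subseteq> W" using chart_inv_image(2)[OF c(1)] WU by auto
  ultimately have "continuous_on (chart_inv c ` W) (\<lambda>y. (f \<circ> chart_inv c) (snd c y))"
    by (rule continuous_on_compose2)
  moreover have "(f \<circ> chart_inv c) (snd c y) = f y" if "y \<in> chart_inv c ` W" for y
    using chart_inv_chart[OF c(1)] that sub by auto
  ultimately have "continuous_on (chart_inv c ` W) f"
    by (simp cong: continuous_on_cong)
  moreover have "x \<in> chart_inv c ` W"
    using chart_inv_chart[OF c(1,3)] c(2) by (intro image_eqI[of _ _ "snd c x"]) (auto simp: W_def)
  ultimately show "isCont f x" using continuous_on_eq_continuous_at[OF W] by blast
qed

text \<open>Otherwise \<open>f\<close> would be constant on every coordinate ball, hence locally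
  constant, and so constant because the manifold is connected.\<close>

lemma nonconstant_chart:
  assumes nc: "f a \<noteq> (f b :: real)"
  shows "\<exists>c\<in>A. \<exists>u0 R. \<exists>u\<in>ball u0 R. \<exists>v\<in>ball u0 R. cball u0 R \<subseteq> snd c ` fst c \<and>
    f (chart_inv c u) \<noteq> f (chart_inv c v)"
proof (rule ccontr)
  assume contr: "\<not> ?thesis"
  have const: "f (chart_inv c u) = f (chart_inv c v)"
    if "c \<in> A" "cball u0 R \<subseteq> snd c ` fst c" "u \<in> ball u0 R" "v \<in> ball u0 R" for c u0 R u v
    using contr that by blast
  have "connected (UNIV :: 'x set)" using manifold unfolding riemannian_manifold_def by blast
  then have "f constant_on UNIV"
  proof (rule locally_constant_imp_constant)
    fix x
    obtain c R where c: "c \<in> A" "R > 0" "x \<in> fst c" "cball (snd c x) R \<subseteq> snd c ` fst c"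
      using chart_ball_exists by blast
    have WU: "ball (snd c x) R \<subseteq> snd c ` fst c" using c(4) ball_subset_cball by blast
    have W: "open (chart_inv c ` ball (snd c x) R)" by (rule chart_image_open[OF c(1) _ WU]) simp
    have x: "x = chart_inv c (snd c x)" using chart_inv_chart[OF c(1,3)] by simp
    have xb: "snd c x \<in> ball (snd c x) R" using c(2) by simp
    define T where "T = chart_inv c ` ball (snd c x) R"
    have "f y = f x" if y: "y \<in> T" for y
    proof -
      obtain z where "z \<in> ball (snd c x) R" "y = chart_inv c z" using y unfolding T_def by (rule imageE)
      then have "f y = f (chart_inv c (snd c x))" using const[OF c(1,4) _ xb] by simp
      then show ?thesis by (simp flip: x)
    qed
    moreover have "x \<in> T" unfolding T_def by (rule image_eqI[where x = "snd c x"]) (fact x xb)+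
    moreover have "openin (top_of_set UNIV) T" using W unfolding T_def by simp
    ultimately show "\<exists>T. openin (top_of_set UNIV) T \<and> x \<in> T \<and> (\<forall>y\<in>T. f y = f x)"
      by (intro exI[of _ T] conjI ballI)
  qed
  then show False using nc unfolding constant_on_def by (metis UNIV_I)
qed

text \<open>One coordinate ball on which \<open>f\<close> is not constant suffices: the Lebesgue
  estimate there carries over to the volume with the loss of a factor \<open>g0\<close>.\<close>

lemma volume_oscillation:
  assumes vol: "is_riemannian_volume A G vol" and \<alpha>: "0 < \<alpha>"
    and hoel: "hoelder_continuous (riemannian_dist A G) \<alpha> f" and nc: "f a \<noteq> f b"
  shows "\<exists>\<kappa>>0. \<exists>s0>0. \<forall>s\<ge>s0. \<forall>\<theta>.
    ennreal (\<kappa> * s powr (1 - 1 / \<alpha>)) \<le> emeasure vol {x. cos (s * f x - \<theta>) \<le> 0}"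
proof -
  obtain c u0 R u v where c: "c \<in> A" and uv: "u \<in> ball u0 R" "v \<in> ball u0 R"
    and sub: "cball u0 R \<subseteq> snd c ` fst c" and ne: "f (chart_inv c u) \<noteq> f (chart_inv c v)"
    using nonconstant_chart[OF nc] by blast
  obtain C where C: "\<And>u v. u \<in> ball u0 R \<Longrightarrow> v \<in> ball u0 R \<Longrightarrow>
      \<bar>f (chart_inv c u) - f (chart_inv c v)\<bar> \<le> C * norm (u - v) powr \<alpha>"
    using hoelder_chart[OF \<alpha> hoel c sub] by blast
  obtain \<kappa> s0 where \<kappa>: "\<kappa> > 0" "s0 > 0" "\<And>s \<theta>. s \<ge> s0 \<Longrightarrow>
      ennreal (\<kappa> * s powr (1 - 1 / \<alpha>)) \<le> emeasure lborel {z \<in> ball u0 R. cos (s * f (chart_inv c z) - \<theta>) \<le> 0}"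
    using oscillation_ball[OF \<alpha> C uv ne] by blast
  obtain g0 where g0: "g0 > 0" "\<And>Q. Q \<in> sets borel \<Longrightarrow> Q \<subseteq> ball u0 R \<Longrightarrow>
      ennreal g0 * emeasure lborel Q \<le> emeasure vol (chart_inv c ` Q)"
    using volume_ge_lebesgue_chart[OF vol c sub] by blast
  have f: "continuous_on UNIV f" by (rule hoelder_imp_continuous[OF \<alpha> hoel])
  have h: "continuous_on (ball u0 R) (\<lambda>z. f (chart_inv c z))"
    by (rule hoelder_imp_continuous_on[OF \<alpha> C])
  have "ennreal (g0 * \<kappa> * s powr (1 - 1 / \<alpha>)) \<le> emeasure vol {x. cos (s * f x - \<theta>) \<le> 0}" if s: "s \<ge> s0" for s \<theta>
  proof -
    define Q where "Q = {z \<in> ball u0 R. cos (s * f (chart_inv c z) - \<theta>) \<le> 0}"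
    have Q: "Q \<in> sets borel" unfolding Q_def
      by (intro borel_Collect_le_open continuous_intros h) auto
    have "ennreal (g0 * \<kappa> * s powr (1 - 1 / \<alpha>)) = ennreal g0 * ennreal (\<kappa> * s powr (1 - 1 / \<alpha>))"
      using g0 \<kappa> by (simp add: ennreal_mult mult.assoc)
    also have "\<dots> \<le> ennreal g0 * emeasure lborel Q"
      unfolding Q_def using \<kappa>(3)[OF s] by (intro mult_left_mono) auto
    also have "\<dots> \<le> emeasure vol (chart_inv c ` Q)"
      by (rule g0(2)[OF Q]) (auto simp: Q_def)
    also have "\<dots> \<le> emeasure vol {x. cos (s * f x - \<theta>) \<le> 0}"
    proof (rule emeasure_mono)
      have "closed {x. cos (s * f x - \<theta>) \<le> 0}"
        by (intro closed_Collect_le continuous_intros f)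
      then show "{x. cos (s * f x - \<theta>) \<le> 0} \<in> sets vol"
        using vol unfolding is_riemannian_volume_def by auto
    qed (auto simp: Q_def)
    finally show ?thesis .
  qed
  moreover have "g0 * \<kappa> > 0" using g0 \<kappa> by simp
  ultimately show ?thesis
    by (intro exI[of _ "g0 * \<kappa>"] conjI exI[of _ s0] \<kappa>(2)) simp_all
qed

end

subsection \<open>Decay of oscillating integrals\<close>

lemma abs_sin_of_nat_mult_le: "\<bar>sin (real n * x)\<bar> \<le> real n * \<bar>sin x\<bar>"
proof (induction n)
  case (Suc n)
  have "real (Suc n) * x = real n * x + x" by (simp add: distrib_right)
  then have "\<bar>sin (real (Suc n) * x)\<bar> = \<bar>sin (real n * x) * cos x + cos (real n * x) * sin x\<bar>"
    by (simp only: sin_add)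
  also have "\<dots> \<le> \<bar>sin (real n * x)\<bar> * \<bar>cos x\<bar> + \<bar>cos (real n * x)\<bar> * \<bar>sin x\<bar>"
    by (metis abs_mult abs_triangle_ineq)
  also have "\<dots> \<le> \<bar>sin (real n * x)\<bar> * 1 + 1 * \<bar>sin x\<bar>"
    by (intro add_mono mult_mono) auto
  finally show ?case using Suc.IH by (simp add: distrib_right)
qed simp

text \<open>The half-angle formula \<open>1 - cos y = 2 * (sin (y / 2))\<^sup>2\<close> reduces this
  to the sublinear growth of \<open>\<bar>sin (n * x)\<bar>\<close> in \<open>n\<close>.\<close>

lemma one_minus_cos_of_nat_mult_le:
  "1 - cos (real n * x) \<le> (real n)\<^sup>2 * (1 - cos x)"
proof -
  have "1 - cos y = 2 * (sin (y / 2))\<^sup>2" for y :: real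
    using cos_double_sin[of "y / 2"] by simp
  moreover have "(sin (real n * x / 2))\<^sup>2 \<le> (real n * \<bar>sin (x / 2)\<bar>)\<^sup>2"
    using abs_sin_of_nat_mult_le[of n "x / 2"] by (metis abs_ge_zero power2_abs power_mono times_divide_eq_right)
  ultimately show ?thesis by (simp add: power_mult_distrib)
qed

text \<open>The scaling \<open>1 - cos (N x) \<le> N\<^sup>2 (1 - cos x)\<close> carries the estimate for large frequencies down
  to all frequencies bounded away from \<open>0\<close>.\<close>

lemma (in finite_measure) integral_one_minus_cos_ge:
  fixes f :: "'a \<Rightarrow> real"
  assumes f[measurable]: "f \<in> borel_measurable M"
    and osc: "\<And>s \<theta>. s \<ge> s0 \<Longrightarrow> ennreal (\<kappa> * s powr (- \<beta>)) \<le> emeasure M {x \<in> space M. cos (s * f x - \<theta>) \<le> 0}"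
    and "\<kappa> > 0" "s0 > 0" "c > 0"
  shows "\<exists>\<kappa>'>0. \<forall>s\<ge>c. \<forall>\<theta>. \<kappa>' * s powr (- \<beta>) \<le> (\<integral>x. 1 - cos (s * f x - \<theta>) \<partial>M)"
proof -
  have int: "integrable M (\<lambda>x. 1 - cos (s * f x - \<theta>))" for s \<theta>
  proof (rule integrable_const_bound[of _ 2])
    have "norm (1 - cos y) \<le> 2" for y :: real
      using cos_ge_minus_one[of y] cos_le_one[of y] by simp
    then show "AE x in M. norm (1 - cos (s * f x - \<theta>)) \<le> 2" by simp
  qed measurable
  have large: "\<kappa> * s powr (- \<beta>) \<le> (\<integral>x. 1 - cos (s * f x - \<theta>) \<partial>M)" if "s \<ge> s0" for s \<theta>
  proof -
    let ?E = "{x \<in> space M. cos (s * f x - \<theta>) \<le> 0}"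
    have "ennreal (\<kappa> * s powr (- \<beta>)) \<le> ennreal (measure M ?E)"
      using osc[OF that] by (simp add: emeasure_eq_measure)
    then have "\<kappa> * s powr (- \<beta>) \<le> measure M ?E" by simp
    also have "\<dots> = (\<integral>x. indicator ?E x \<partial>M)" by simp
    \<comment> \<open>On \<open>?E\<close> the integrand is at least 1, elsewhere it is
      nonnegative.\<close>
    also have "\<dots> \<le> (\<integral>x. 1 - cos (s * f x - \<theta>) \<partial>M)"
    proof (rule integral_mono[OF _ int])
      show "integrable M (indicator ?E :: 'a \<Rightarrow> real)"
        by (rule integrable_real_indicator) (auto simp: emeasure_eq_measure)
    qed (auto simp: indicator_def)
    finally show ?thesis .
  qed
  \<comment> \<open>With this \<open>N\<close>, multiplication by \<open>N\<close> takes every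
    frequency \<open>s \<ge> c\<close> into the range \<open>s \<ge> s0\<close>, where
    \<open>osc\<close> applies. The price is the factor \<open>(real N)\<^sup>2\<close> in the
    denominator of \<open>\<kappa>'\<close>.\<close>
  define N where "N = nat \<lceil>s0 / c\<rceil> + 1"
  have N: "real N * c \<ge> s0" "N \<ge> 1"
  proof -
    have "s0 / c \<le> real N" unfolding N_def by linarith
    then show "real N * c \<ge> s0" using \<open>c > 0\<close> by (simp add: field_simps)
  qed (simp add: N_def)
  define \<kappa>' where "\<kappa>' = \<kappa> * real N powr (- \<beta>) / (real N)\<^sup>2"
  have "\<kappa>' * s powr (- \<beta>) \<le> (\<integral>x. 1 - cos (s * f x - \<theta>) \<partial>M)" if s: "s \<ge> c" for s \<theta>
  proof -
    have "real N * c \<le> real N * s" using s by (intro mult_left_mono) auto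
    then have "s0 \<le> real N * s" using N by linarith
    then have "\<kappa> * (real N * s) powr (- \<beta>) \<le> (\<integral>x. 1 - cos (real N * s * f x - real N * \<theta>) \<partial>M)"
      by (rule large)
    also have "\<dots> \<le> (\<integral>x. (real N)\<^sup>2 * (1 - cos (s * f x - \<theta>)) \<partial>M)"
    proof (rule integral_mono)
      fix x
      show "1 - cos (real N * s * f x - real N * \<theta>) \<le> (real N)\<^sup>2 * (1 - cos (s * f x - \<theta>))"
        using one_minus_cos_of_nat_mult_le[of N "s * f x - \<theta>"] by (simp add: algebra_simps)
    qed (intro int integrable_mult_right)+
    also have "\<dots> = (real N)\<^sup>2 * (\<integral>x. 1 - cos (s * f x - \<theta>) \<partial>M)" by simp
    finally show ?thesis using s \<open>c > 0\<close> N(2) by (simp add: \<kappa>'_def powr_mult field_simps)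
  qed
  moreover have "\<kappa>' > 0" using \<open>\<kappa> > 0\<close> N(2) by (simp add: \<kappa>'_def)
  ultimately show ?thesis by blast
qed

text \<open>Rotating the integral by its own argument \<open>\<theta>\<close> makes it real and
  nonnegative, so its modulus is the integral of \<open>cos (s * f x - \<theta>)\<close>. This is
  why the lower bound is required uniformly in the phase.\<close>

lemma (in finite_measure) norm_integral_cis_le:
  fixes f :: "'a \<Rightarrow> real"
  assumes f[measurable]: "f \<in> borel_measurable M"
    and lower: "\<And>s \<theta>. s \<ge> c \<Longrightarrow> \<eta> s \<le> (\<integral>x. 1 - cos (s * f x - \<theta>) \<partial>M)"
    and s: "\<bar>s\<bar> \<ge> c"
  shows "norm (\<integral>x. cis (s * f x) \<partial>M) \<le> measure M (space M) - \<eta> \<bar>s\<bar>"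
proof -
  \<comment> \<open>A negative frequency reduces to a positive one because the cosine is even; the
    phase changes sign too.\<close>
  have lower': "\<eta> \<bar>s\<bar> \<le> (\<integral>x. 1 - cos (s * f x - \<theta>) \<partial>M)" for \<theta>
  proof (cases "s \<ge> 0")
    case False
    have "cos (\<bar>s\<bar> * f x - (- \<theta>)) = cos (s * f x - \<theta>)" for x
      using False cos_minus[of "s * f x - \<theta>"] by (simp add: abs_if algebra_simps)
    then show ?thesis using lower[OF s, of "- \<theta>"] by simp
  qed (use lower[OF s] in simp)
  have [measurable]: "cis \<in> borel_measurable borel"
    by (intro borel_measurable_continuous_onI continuous_on_cis continuous_on_id)
  have int_cis: "integrable M (\<lambda>x. cis (s * f x))"
    by (rule integrable_const_bound[of _ 1]) auto
  have int_cos: "integrable M (\<lambda>x. cos (s * f x - \<theta>))" for \<theta>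
    by (rule integrable_const_bound[of _ 1]) auto
  define z where "z = (\<integral>x. cis (s * f x) \<partial>M)"
  define \<theta> where "\<theta> = Arg z"
  have "complex_of_real (norm z) = cis (- \<theta>) * z"
    using rcis_cmod_Arg[of z] by (metis \<theta>_def cis_mult cis_zero mult.assoc mult.commute mult.right_neutral rcis_def add.left_inverse)
  also have "\<dots> = (\<integral>x. cis (s * f x - \<theta>) \<partial>M)"
    unfolding z_def using int_cis by (simp flip: integral_mult_right_zero add: cis_mult)
  finally have "norm z = Re (\<integral>x. cis (s * f x - \<theta>) \<partial>M)" by (metis Re_complex_of_real)
  also have "\<dots> = (\<integral>x. Re (cis (s * f x - \<theta>)) \<partial>M)"
    by (rule integral_Re[symmetric], rule integrable_const_bound[of _ 1]) auto
  also have "\<dots> = (\<integral>x. cos (s * f x - \<theta>) \<partial>M)" by simp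
  also have "\<dots> = measure M (space M) - (\<integral>x. 1 - cos (s * f x - \<theta>) \<partial>M)"
    using int_cos by simp
  also have "\<dots> \<le> measure M (space M) - \<eta> \<bar>s\<bar>" using lower'[of \<theta>] by simp
  finally show ?thesis by (simp add: z_def)
qed

subsection \<open>Contraction of the Markov operator\<close>

text \<open>Complex functions are required because the weights are exponentials of imaginary
  multiples of \<open>f\<close>; on real functions this is \<open>markov_operator\<close>.\<close>

definition complex_markov_operator ::
  "'x measure \<Rightarrow> ('x \<Rightarrow> 'x \<Rightarrow> real) \<Rightarrow> ('x \<Rightarrow> complex) \<Rightarrow> 'x \<Rightarrow> complex" where
  "complex_markov_operator vol p g x = (\<integral>y. p x y * g y \<partial>vol)"

section \<open>Minorisation of the transition density\<close>

locale doeblin_density =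
  fixes vol :: "'x::topological_space measure" and p :: "'x \<Rightarrow> 'x \<Rightarrow> real" and \<delta> :: real
  assumes sets_vol: "sets vol = sets borel"
    and density: "transition_density vol p"
    and \<delta>: "\<delta> > 0" "\<And>x y. \<delta> \<le> p x y"
begin

abbreviation "T \<equiv> complex_markov_operator vol p"
abbreviation "q \<equiv> \<delta> * measure vol UNIV"

lemma space_vol: "space vol = UNIV"
  using sets_eq_imp_space_eq[OF sets_vol] by simp

lemma p_measurable: "(\<lambda>(x, y). p x y) \<in> borel_measurable (borel \<Otimes>\<^sub>M borel)"
  using density by (simp add: transition_density_def)

lemma borel_imp_measurable: "g \<in> borel_measurable borel \<Longrightarrow> g \<in> borel_measurable vol"
  by (simp add: measurable_cong_sets[OF sets_vol refl])

lemma p_measurable_snd: "p x \<in> borel_measurable vol"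
  using measurable_Pair2[OF p_measurable, of x] by (intro borel_imp_measurable) simp

lemma p_nn_integral: "(\<integral>\<^sup>+y. ennreal (p x y) \<partial>vol) = 1"
  using density by (simp add: transition_density_def)

lemma p_pos: "p x y > 0"
  using density by (simp add: transition_density_def)

lemma p_integrable: "integrable vol (p x)"
  using p_nn_integral[of x] p_pos[of x] by (intro integrableI_bounded p_measurable_snd) (simp add: less_imp_le)

lemma p_integral: "(\<integral>y. p x y \<partial>vol) = 1"
  using p_nn_integral[of x] p_pos[of x] integral_eq_nn_integral[OF p_measurable_snd[of x]] by (simp add: less_imp_le)

text \<open>A density with integral 1 that stays above \<open>\<delta>\<close> forces the total
  volume to be at most \<open>1 / \<delta>\<close>.\<close>

sublocale finite_measure vol
proof
  obtain x :: 'x where True by simp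
  have "ennreal \<delta> * emeasure vol (space vol) = (\<integral>\<^sup>+y. ennreal \<delta> \<partial>vol)" by simp
  also have "\<dots> \<le> (\<integral>\<^sup>+y. ennreal (p x y) \<partial>vol)" by (intro nn_integral_mono ennreal_leI \<delta>)
  finally have "ennreal \<delta> * emeasure vol (space vol) \<le> 1" by (simp add: p_nn_integral)
  then show "emeasure vol (space vol) \<noteq> \<infinity>"
    using \<delta>(1) by (auto simp: ennreal_mult_top top_unique)
qed

text \<open>\<open>q\<close> is the mass of the common part \<open>\<delta> * vol\<close> of all
  transition probabilities. It is at most 1 because \<open>p x\<close> integrates to 1, and positive
  because a null measure would give that integral the value 0.\<close>

lemma q: "0 < q" "q \<le> 1"
proof -
  obtain x :: 'x where True by simp
  have "q = (\<integral>y. \<delta> \<partial>vol)" by (simp add: space_vol)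
  also have "\<dots> \<le> (\<integral>y. p x y \<partial>vol)" by (intro integral_mono p_integrable \<delta>) simp
  finally show "q \<le> 1" by (simp add: p_integral)
  have "measure vol UNIV \<noteq> 0"
  proof
    assume "measure vol UNIV = 0"
    then have "emeasure vol (space vol) = 0" by (simp add: emeasure_eq_measure space_vol)
    then have "AE y in vol. False" by (intro AE_I[of _ _ "space vol"]) auto
    then have "(\<integral>\<^sup>+y. ennreal (p x y) \<partial>vol) = (\<integral>\<^sup>+y. 0 \<partial>vol)"
      by (intro nn_integral_cong_AE) auto
    then show False by (simp add: p_nn_integral)
  qed
  then show "0 < q" using \<delta> measure_nonneg[of vol UNIV] by (simp add: less_le)
qed

lemma bounded_integrable:
  fixes g :: "'x \<Rightarrow> 'b::{banach,second_countable_topology}"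
  assumes "g \<in> borel_measurable borel" "\<And>y. norm (g y) \<le> H"
  shows "integrable vol g"
  using assms by (intro integrable_const_bound[of _ H] borel_imp_measurable) auto

text \<open>It serves both for the kernel \<open>p x\<close> and for the nonnegative remainder
  \<open>p x - \<delta>\<close>, whose masses are 1 and \<open>1 - q\<close>.\<close>

lemma kernel_integral_bound:
  fixes k :: "'x \<Rightarrow> real" and g :: "'x \<Rightarrow> complex"
  assumes k: "integrable vol k" "\<And>y. 0 \<le> k y" and g: "g \<in> borel_measurable borel" "\<And>y. norm (g y) \<le> H"
  shows "integrable vol (\<lambda>y. k y * g y)" "norm (\<integral>y. k y * g y \<partial>vol) \<le> (\<integral>y. k y \<partial>vol) * H"
proof -
  have bd: "norm (k y * g y) \<le> k y * H" for y
    using k(2)[of y] g(2)[of y] by (simp add: norm_mult mult_left_mono)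
  have m: "(\<lambda>y. k y * g y) \<in> borel_measurable vol"
    using borel_measurable_integrable[OF k(1)] borel_imp_measurable[OF g(1)] by measurable
  have kH: "integrable vol (\<lambda>y. k y * H)" using k(1) by simp
  show int: "integrable vol (\<lambda>y. k y * g y)"
    by (rule Bochner_Integration.integrable_bound[OF kH m]) (use bd in \<open>auto intro!: AE_I2 order_trans[OF _ abs_ge_self]\<close>)
  have "norm (\<integral>y. k y * g y \<partial>vol) \<le> (\<integral>y. norm (k y * g y) \<partial>vol)" by (rule integral_norm_bound)
  also have "\<dots> \<le> (\<integral>y. k y * H \<partial>vol)" by (rule integral_mono) (use int kH bd in auto)
  finally show "norm (\<integral>y. k y * g y \<partial>vol) \<le> (\<integral>y. k y \<partial>vol) * H" by simp
qed

lemma T_measurable: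
  assumes "g \<in> borel_measurable borel"
  shows "T g \<in> borel_measurable borel"
proof -
  have [measurable]: "g \<in> borel_measurable borel" by fact
  have [measurable]: "(\<lambda>(x, y). p x y) \<in> borel_measurable (borel \<Otimes>\<^sub>M borel)" by (rule p_measurable)
  have "(\<lambda>(x, y). complex_of_real (p x y) * g y) \<in> borel_measurable (borel \<Otimes>\<^sub>M borel)"
    by measurable
  then have "(\<lambda>(x, y). complex_of_real (p x y) * g y) \<in> borel_measurable (borel \<Otimes>\<^sub>M vol)"
    by (subst measurable_cong_sets[OF sets_pair_measure_cong[OF refl sets_vol] refl])
  then show ?thesis unfolding complex_markov_operator_def
    by (rule borel_measurable_lebesgue_integral)
qed

lemma T_bound:
  assumes "g \<in> borel_measurable borel" "\<And>y. norm (g y) \<le> H"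
  shows "norm (T g x) \<le> H"
  using kernel_integral_bound(2)[OF p_integrable _ assms, of x] p_pos[of x]
  by (simp add: complex_markov_operator_def p_integral less_imp_le)

text \<open>Splitting \<open>p = \<delta> + (p - \<delta>)\<close>: the part \<open>\<delta>\<close> forgets the starting point and leaves the plain
  integral of the argument.\<close>

lemma T_split:
  fixes g :: "'x \<Rightarrow> complex"
  assumes "g \<in> borel_measurable borel" "\<And>y. norm (g y) \<le> H"
  shows "T g x = \<delta> * (\<integral>y. g y \<partial>vol) + (\<integral>y. (p x y - \<delta>) * g y \<partial>vol)"
    and "norm (\<integral>y. (p x y - \<delta>) * g y \<partial>vol) \<le> (1 - q) * H"
proof -
  have k: "integrable vol (\<lambda>y. p x y - \<delta>)" "\<And>y. 0 \<le> p x y - \<delta>" using p_integrable \<delta> by auto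
  note rest = kernel_integral_bound[OF k assms]
  have g: "integrable vol g" by (rule bounded_integrable[OF assms])
  have "T g x = (\<integral>y. \<delta> * g y + (p x y - \<delta>) * g y \<partial>vol)"
    unfolding complex_markov_operator_def by (simp add: algebra_simps)
  also have "\<dots> = (\<integral>y. \<delta> * g y \<partial>vol) + (\<integral>y. (p x y - \<delta>) * g y \<partial>vol)"
    by (rule Bochner_Integration.integral_add) (use g rest(1) in auto)
  finally show "T g x = \<delta> * (\<integral>y. g y \<partial>vol) + (\<integral>y. (p x y - \<delta>) * g y \<partial>vol)" by simp
  have "(\<integral>y. p x y - \<delta> \<partial>vol) = 1 - q"
    using p_integrable[of x] by (simp add: p_integral space_vol mult.commute)
  then show "norm (\<integral>y. (p x y - \<delta>) * g y \<partial>vol) \<le> (1 - q) * H" using rest(2) by simp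
qed

text \<open>The inner \<open>T k\<close> is a constant \<open>K\<close> of size at most
  \<open>q * H\<close> plus a remainder \<open>r\<close> of size at most \<open>(1 - q) * H\<close>.
  The constant comes out, leaving \<open>T g\<close>, and splitting \<open>T g\<close> in turn
  exposes the integral of \<open>g\<close>, where cancellation acts. The remaining losses add up to
  \<open>q * (1 - q) + (1 - q) = 1 - q\<^sup>2\<close>.\<close>

lemma T_T_bound:
  assumes g: "g \<in> borel_measurable borel" "\<And>y. norm (g y) \<le> E" "norm (\<integral>y. g y \<partial>vol) \<le> I"
    and k: "k \<in> borel_measurable borel" "\<And>y. norm (k y) \<le> H"
  shows "norm (T (\<lambda>y. g y * T k y) x) \<le> (q * (\<delta> * I) + (1 - q\<^sup>2) * E) * H"
proof -
  obtain y0 :: 'x where True by simp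
  have H0: "0 \<le> H" and E0: "0 \<le> E" using k(2)[of y0] g(2)[of y0] norm_ge_zero order_trans by blast+
  \<comment> \<open>\<open>K\<close> is the part of \<open>T k\<close> that does not depend on the
    starting point.\<close>
  define K where "K = \<delta> * (\<integral>y. k y \<partial>vol)"
  define r where "r y = T k y - K" for y
  have r: "norm (r y) \<le> (1 - q) * H" for y
    using T_split[OF k, of y] by (simp add: r_def K_def)
  have rm: "r \<in> borel_measurable borel" unfolding r_def using T_measurable[OF k(1)] by simp
  have "norm (\<integral>y. k y \<partial>vol) \<le> (\<integral>y. H \<partial>vol)"
    by (rule order_trans[OF integral_norm_bound])
       (intro integral_mono, use bounded_integrable[OF k] k(2) in auto)
  then have K: "norm K \<le> q * H" using \<delta> by (simp add: K_def norm_mult space_vol)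
  have gr: "(\<lambda>y. g y * r y) \<in> borel_measurable borel" "\<And>y. norm (g y * r y) \<le> E * ((1 - q) * H)"
    using g(1) rm r g(2) E0 by (auto simp: norm_mult intro!: mult_mono)
  have Kg: "(\<lambda>y. K * g y) \<in> borel_measurable borel" "\<And>y. norm (K * g y) \<le> norm K * E"
    using g(1,2) by (auto simp: norm_mult intro!: mult_left_mono)
  have "T (\<lambda>y. g y * T k y) x = (\<integral>y. p x y * (K * g y) + p x y * (g y * r y) \<partial>vol)"
    unfolding complex_markov_operator_def[of vol p "\<lambda>y. g y * T k y"] by (simp add: r_def algebra_simps)
  also have "\<dots> = (\<integral>y. p x y * (K * g y) \<partial>vol) + (\<integral>y. p x y * (g y * r y) \<partial>vol)"
    by (intro Bochner_Integration.integral_add kernel_integral_bound(1)[OF p_integrable _ Kg]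
        kernel_integral_bound(1)[OF p_integrable _ gr]) (simp_all add: less_imp_le[OF p_pos])
  also have "(\<integral>y. p x y * (K * g y) \<partial>vol) = K * T g x"
    by (simp add: complex_markov_operator_def mult.left_commute flip: integral_mult_right_zero)
  also have "(\<integral>y. p x y * (g y * r y) \<partial>vol) = T (\<lambda>y. g y * r y) x"
    by (simp add: complex_markov_operator_def)
  finally have "norm (T (\<lambda>y. g y * T k y) x) \<le> norm K * norm (T g x) + norm (T (\<lambda>y. g y * r y) x)"
    by (metis norm_mult norm_triangle_ineq)
  moreover have "norm (T (\<lambda>y. g y * r y) x) \<le> E * ((1 - q) * H)" by (rule T_bound[OF gr])
  moreover have "norm K * norm (T g x) \<le> (q * H) * (\<delta> * I + (1 - q) * E)"
  proof (rule mult_mono[OF K])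
    have "norm (T g x) \<le> \<delta> * norm (\<integral>y. g y \<partial>vol) + norm (\<integral>y. (p x y - \<delta>) * g y \<partial>vol)"
      unfolding T_split(1)[OF g(1,2)] using \<delta>(1) by (intro norm_triangle_le) (simp only: norm_mult norm_of_real abs_of_pos order_refl)
    also have "\<dots> \<le> \<delta> * I + (1 - q) * E"
      using \<delta>(1) g(3) by (intro add_mono T_split(2)[OF g(1,2)] mult_left_mono) auto
    finally show "norm (T g x) \<le> \<delta> * I + (1 - q) * E" .
  qed (use q H0 in auto)
  ultimately show ?thesis by (simp add: algebra_simps power2_eq_square)
qed

end

section \<open>Expectations of products along the chain\<close>

locale doeblin_chain = doeblin_density vol p \<delta>
  for vol :: "'x::topological_space measure" and p \<delta> +
  fixes M :: "'w measure" and \<xi> :: "nat \<Rightarrow> 'w \<Rightarrow> 'x"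
  assumes chain: "homogeneous_markov_chain M \<xi> (markov_operator vol p)"
begin

sublocale P: prob_space M
  using chain by (simp add: homogeneous_markov_chain_def)

lemma xi_measurable[measurable]: "\<xi> n \<in> borel_measurable M"
  using chain by (simp add: homogeneous_markov_chain_def)

lemma past_map_measurable: "(\<lambda>\<omega>. \<lambda>i\<in>{..n}. \<xi> i \<omega>) \<in> M \<rightarrow>\<^sub>M (\<Pi>\<^sub>M i\<in>{..n}. borel)"
  by (intro measurable_restrict xi_measurable)

lemma space_past: "space (past_algebra M \<xi> n) = space M"
  by (simp add: past_algebra_def)

lemma subalgebra_past: "subalgebra M (past_algebra M \<xi> n)"
  unfolding subalgebra_def
proof
  show "space (past_algebra M \<xi> n) = space M" by (rule space_past)
  have "past_map \<in> space M \<rightarrow> space (\<Pi>\<^sub>M i\<in>{..n}. borel)"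
    if "past_map = (\<lambda>\<omega>. \<lambda>i\<in>{..n}. \<xi> i \<omega>)" for past_map
    unfolding that using measurable_space[OF past_map_measurable] by blast
  then show "sets (past_algebra M \<xi> n) \<subseteq> sets M"
    unfolding past_algebra_def
    by (subst sets_vimage_algebra2) (auto intro!: measurable_sets[OF past_map_measurable])
qed

lemma xi_past_measurable:
  assumes "j \<le> n"
  shows "\<xi> j \<in> borel_measurable (past_algebra M \<xi> n)"
proof -
  have "(\<lambda>\<omega>. \<lambda>i\<in>{..n}. \<xi> i \<omega>) \<in> past_algebra M \<xi> n \<rightarrow>\<^sub>M (\<Pi>\<^sub>M i\<in>{..n}. borel)"
    unfolding past_algebra_def
    by (rule measurable_vimage_algebra1) (use measurable_space[OF past_map_measurable] in blast)
  then have "(\<lambda>\<omega>. (\<lambda>i\<in>{..n}. \<xi> i \<omega>) j) \<in> borel_measurable (past_algebra M \<xi> n)"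
    by (rule measurable_compose[OF _ measurable_component_singleton]) (use assms in simp)
  moreover have "(\<lambda>\<omega>. (\<lambda>i\<in>{..n}. \<xi> i \<omega>) j) = \<xi> j" using assms by (simp add: restrict_def)
  ultimately show ?thesis by (simp only:)
qed

lemma T_of_real: "T (\<lambda>y. complex_of_real (g y)) x = complex_of_real (markov_operator vol p g x)"
  unfolding complex_markov_operator_def markov_operator_def
  by (simp only: of_real_mult[symmetric] integral_complex_of_real)

lemma T_Re_Im:
  assumes "g \<in> borel_measurable borel" "\<And>y. norm (g y) \<le> H"
  shows "Re (T g x) = markov_operator vol p (\<lambda>y. Re (g y)) x"
    and "Im (T g x) = markov_operator vol p (\<lambda>y. Im (g y)) x"
proof -
  have int: "integrable vol (\<lambda>y. complex_of_real (p x y) * g y)"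
    by (rule kernel_integral_bound(1)[OF p_integrable _ assms]) (simp add: less_imp_le[OF p_pos])
  show "Re (T g x) = markov_operator vol p (\<lambda>y. Re (g y)) x"
    unfolding complex_markov_operator_def markov_operator_def integral_Re[OF int, symmetric] by simp
  show "Im (T g x) = markov_operator vol p (\<lambda>y. Im (g y)) x"
    unfolding complex_markov_operator_def markov_operator_def integral_Im[OF int, symmetric] by simp
qed

lemma markov_operator_measurable_bounded:
  assumes "g \<in> borel_measurable borel" "\<And>y. \<bar>g y\<bar> \<le> H"
  shows "markov_operator vol p g \<in> borel_measurable borel" "\<bar>markov_operator vol p g x\<bar> \<le> H"
proof -
  have g: "(\<lambda>y. complex_of_real (g y)) \<in> borel_measurable borel" using assms(1) by measurable
  have "(\<lambda>x. Re (T (\<lambda>y. complex_of_real (g y)) x)) \<in> borel_measurable borel"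
    using T_measurable[OF g] by measurable
  then show "markov_operator vol p g \<in> borel_measurable borel" by (simp add: T_of_real)
  show "\<bar>markov_operator vol p g x\<bar> \<le> H"
    using T_bound[OF g, of H x] assms(2) by (simp add: T_of_real)
qed

text \<open>A weight measurable with respect to the past may be moved inside the conditional
  expectation, which the Markov property then evaluates.\<close>

lemma markov_step_real:
  fixes Y :: "'w \<Rightarrow> real" and g :: "'x \<Rightarrow> real"
  assumes Y: "Y \<in> borel_measurable (past_algebra M \<xi> n)" "\<And>\<omega>. \<bar>Y \<omega>\<bar> \<le> C"
    and g: "g \<in> borel_measurable borel" "\<And>y. \<bar>g y\<bar> \<le> H"
  shows "(\<integral>\<omega>. Y \<omega> * g (\<xi> (Suc n) \<omega>) \<partial>M) = (\<integral>\<omega>. Y \<omega> * markov_operator vol p g (\<xi> n \<omega>) \<partial>M)"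
proof -
  interpret finite_measure_subalgebra M "past_algebra M \<xi> n"
    by unfold_locales (rule subalgebra_past)
  have Ym[measurable]: "Y \<in> borel_measurable M" by (rule measurable_from_subalg[OF subalgebra_past Y(1)])
  have [measurable]: "g \<in> borel_measurable borel" "markov_operator vol p g \<in> borel_measurable borel"
    using g(1) markov_operator_measurable_bounded(1)[OF g] by auto
  have int: "integrable M (\<lambda>\<omega>. Y \<omega> * g (\<xi> (Suc n) \<omega>))"
    by (rule P.integrable_const_bound[of _ "C * H"])
       (use Y(2) g(2) in \<open>auto simp: abs_mult intro!: mult_mono order_trans[OF abs_ge_zero Y(2)]\<close>)
  have "bounded (range g)" using g(2) by (auto simp: bounded_iff)
  then have ae: "AE \<omega> in M. real_cond_exp M (past_algebra M \<xi> n) (\<lambda>\<omega>. g (\<xi> (Suc n) \<omega>)) \<omega>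
      = markov_operator vol p g (\<xi> n \<omega>)"
    using chain g(1) unfolding homogeneous_markov_chain_def by blast
  have "(\<integral>\<omega>. Y \<omega> * g (\<xi> (Suc n) \<omega>) \<partial>M)
      = (\<integral>\<omega>. Y \<omega> * real_cond_exp M (past_algebra M \<xi> n) (\<lambda>\<omega>. g (\<xi> (Suc n) \<omega>)) \<omega> \<partial>M)"
    by (rule real_cond_exp_intg(2)[OF int Y(1), symmetric]) measurable
  also have "\<dots> = (\<integral>\<omega>. Y \<omega> * markov_operator vol p g (\<xi> n \<omega>) \<partial>M)"
    by (rule integral_cong_AE) (use ae in auto)
  finally show ?thesis .
qed

text \<open>Real and imaginary parts of \<open>Y\<close> and \<open>g\<close> reduce the claim to
  four instances of the real case.\<close>

lemma markov_step:
  fixes Y :: "'w \<Rightarrow> complex" and g :: "'x \<Rightarrow> complex"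
  assumes Y: "Y \<in> borel_measurable (past_algebra M \<xi> n)" "\<And>\<omega>. norm (Y \<omega>) \<le> C"
    and g: "g \<in> borel_measurable borel" "\<And>y. norm (g y) \<le> H"
  shows "(\<integral>\<omega>. Y \<omega> * g (\<xi> (Suc n) \<omega>) \<partial>M) = (\<integral>\<omega>. Y \<omega> * T g (\<xi> n \<omega>) \<partial>M)"
proof -
  have Ym[measurable]: "Y \<in> borel_measurable M" by (rule measurable_from_subalg[OF subalgebra_past Y(1)])
  have [measurable]: "g \<in> borel_measurable borel" "T g \<in> borel_measurable borel"
    using g(1) T_measurable[OF g(1)] by auto
  have Ypart: "(\<lambda>\<omega>. Re (Y \<omega>)) \<in> borel_measurable (past_algebra M \<xi> n)" "(\<lambda>\<omega>. Im (Y \<omega>)) \<in> borel_measurable (past_algebra M \<xi> n)"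
    using Y(1) by measurable
  have Yb: "\<bar>Re (Y \<omega>)\<bar> \<le> C" "\<bar>Im (Y \<omega>)\<bar> \<le> C" for \<omega>
    using Y(2)[of \<omega>] abs_Re_le_cmod[of "Y \<omega>"] abs_Im_le_cmod[of "Y \<omega>"] by linarith+
  have gpart: "(\<lambda>y. Re (g y)) \<in> borel_measurable borel" "(\<lambda>y. Im (g y)) \<in> borel_measurable borel" by measurable
  have gb: "\<bar>Re (g y)\<bar> \<le> H" "\<bar>Im (g y)\<bar> \<le> H" for y
    using g(2)[of y] abs_Re_le_cmod[of "g y"] abs_Im_le_cmod[of "g y"] by linarith+
  have intgen: "integrable M (\<lambda>\<omega>. Y \<omega> * h (\<xi> k \<omega>))"
    if [measurable]: "h \<in> borel_measurable borel" and hb: "\<And>y. norm (h y) \<le> H" for h k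
    by (rule P.integrable_const_bound[of _ "C * H"])
       (use Y(2) hb in \<open>auto simp: norm_mult intro!: mult_mono order_trans[OF norm_ge_zero Y(2)]\<close>)
  have intr: "integrable M (\<lambda>\<omega>. y \<omega> * h (\<xi> k \<omega>))"
    if [measurable]: "h \<in> borel_measurable borel" "y \<in> borel_measurable M"
      and hb: "\<And>y. \<bar>h y\<bar> \<le> H" and yb: "\<And>\<omega>. \<bar>y \<omega>\<bar> \<le> C" for h :: "'x \<Rightarrow> real" and k and y :: "'w \<Rightarrow> real"
    by (rule P.integrable_const_bound[of _ "C * H"])
       (use yb hb in \<open>auto simp: abs_mult intro!: mult_mono order_trans[OF abs_ge_zero yb]\<close>)
  note intL = intgen[OF g, of "Suc n"] and intR = intgen[OF T_measurable[OF g(1)] T_bound[OF g], of n]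
  note R = T_Re_Im[OF g]
  note mo = markov_operator_measurable_bounded[OF gpart(1) gb(1)] markov_operator_measurable_bounded[OF gpart(2) gb(2)]
  have YM: "(\<lambda>\<omega>. Re (Y \<omega>)) \<in> borel_measurable M" "(\<lambda>\<omega>. Im (Y \<omega>)) \<in> borel_measurable M" by measurable
  note ints = intr[OF gpart(1) YM(1) gb(1) Yb(1)] intr[OF gpart(1) YM(2) gb(1) Yb(2)]
    intr[OF gpart(2) YM(1) gb(2) Yb(1)] intr[OF gpart(2) YM(2) gb(2) Yb(2)]
    intr[OF mo(1) YM(1) mo(2) Yb(1)] intr[OF mo(1) YM(2) mo(2) Yb(2)]
    intr[OF mo(3) YM(1) mo(4) Yb(1)] intr[OF mo(3) YM(2) mo(4) Yb(2)]
  note steps = markov_step_real[OF Ypart(1) Yb(1) gpart(1) gb(1)] markov_step_real[OF Ypart(1) Yb(1) gpart(2) gb(2)]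
    markov_step_real[OF Ypart(2) Yb(2) gpart(1) gb(1)] markov_step_real[OF Ypart(2) Yb(2) gpart(2) gb(2)]
  show ?thesis
  proof (rule complex_eqI)
    show "Re (\<integral>\<omega>. Y \<omega> * g (\<xi> (Suc n) \<omega>) \<partial>M) = Re (\<integral>\<omega>. Y \<omega> * T g (\<xi> n \<omega>) \<partial>M)"
      unfolding integral_Re[OF intL, symmetric] integral_Re[OF intR, symmetric] times_complex.sel R
      by (simp only: Bochner_Integration.integral_diff ints steps)
    show "Im (\<integral>\<omega>. Y \<omega> * g (\<xi> (Suc n) \<omega>) \<partial>M) = Im (\<integral>\<omega>. Y \<omega> * T g (\<xi> n \<omega>) \<partial>M)"
      unfolding integral_Im[OF intL, symmetric] integral_Im[OF intR, symmetric] times_complex.sel R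
      by (simp only: Bochner_Integration.integral_add ints steps)
  qed
qed

lemma prod_past_measurable:
  assumes "\<And>j. g j \<in> borel_measurable borel"
  shows "(\<lambda>\<omega>. \<Prod>j=1..n. g j (\<xi> j \<omega>) :: complex) \<in> borel_measurable (past_algebra M \<xi> n)"
  using assms by (intro borel_measurable_prod measurable_compose[OF xi_past_measurable]) auto

lemma prod_norm_bound:
  assumes "\<And>j y. norm (g j y) \<le> (E::real)"
  shows "norm (\<Prod>j=1..n. g j (\<xi> j \<omega>) :: complex) \<le> E ^ n"
proof -
  have "norm (\<Prod>j=1..n. g j (\<xi> j \<omega>)) = (\<Prod>j=1..n. norm (g j (\<xi> j \<omega>)))" by (simp add: prod_norm)
  also have "\<dots> \<le> (\<Prod>j=1..n. E)" by (rule prod_mono) (use assms in auto)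
  finally show ?thesis by simp
qed

lemma markov_step_prod:
  assumes "\<And>j. g j \<in> borel_measurable borel" "\<And>j y. norm (g j y) \<le> (E::real)"
    and "h \<in> borel_measurable borel" "\<And>y. norm (h y) \<le> (H::real)"
  shows "(\<integral>\<omega>. (\<Prod>j=1..n. g j (\<xi> j \<omega>)) * h (\<xi> (Suc n) \<omega>) \<partial>M)
    = (\<integral>\<omega>. (\<Prod>j=1..n. g j (\<xi> j \<omega>)) * T h (\<xi> n \<omega>) \<partial>M)"
proof (rule markov_step[where C = "E ^ n" and H = H])
  show "(\<lambda>\<omega>. \<Prod>j=1..n. g j (\<xi> j \<omega>)) \<in> borel_measurable (past_algebra M \<xi> n)"
    by (rule prod_past_measurable) (rule assms)
  show "norm (\<Prod>j=1..n. g j (\<xi> j \<omega>)) \<le> E ^ n" for \<omega>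
    by (rule prod_norm_bound) (rule assms)
qed (fact assms)+

text \<open>Two applications of the Markov property remove the last two factors and replace
  \<open>h\<close> by a function of the form \<open>T (\<lambda>y. g y * T u y)\<close>, to which
  the two-step contraction applies. The induction therefore runs over all terminal functions
  \<open>h\<close> and bounds \<open>H\<close>.\<close>

lemma expectation_prod_even_bound:
  fixes g :: "nat \<Rightarrow> 'x \<Rightarrow> complex" and h :: "'x \<Rightarrow> complex"
  assumes g: "\<And>j. g j \<in> borel_measurable borel" "\<And>j y. norm (g j y) \<le> E"
      "\<And>j. norm (\<integral>y. g j y \<partial>vol) \<le> I"
    and h: "h \<in> borel_measurable borel" "\<And>y. norm (h y) \<le> H"
  shows "norm (\<integral>\<omega>. (\<Prod>j=1..2*k. g j (\<xi> j \<omega>)) * h (\<xi> (2*k) \<omega>) \<partial>M)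
    \<le> ((q * (\<delta> * I) + (1 - q\<^sup>2) * E) * E) ^ k * H"
  using h
proof (induction k arbitrary: h H)
  case 0
  have "norm (\<integral>\<omega>. h (\<xi> 0 \<omega>) \<partial>M) \<le> (\<integral>\<omega>. norm (h (\<xi> 0 \<omega>)) \<partial>M)" by (rule integral_norm_bound)
  also have "\<dots> \<le> (\<integral>\<omega>. H \<partial>M)"
    using 0 by (intro integral_mono P.integrable_const_bound[of _ H]) (auto intro: order_trans[OF norm_ge_zero])
  finally show ?case by (simp add: P.prob_space)
next
  case (Suc k)
  define \<rho> where "\<rho> = q * (\<delta> * I) + (1 - q\<^sup>2) * E"
  note [measurable] = g(1) Suc.prems(1)
  \<comment> \<open>\<open>u\<close> absorbs the last factor into \<open>h\<close>, and
    \<open>v\<close> below absorbs the last but one into \<open>T u\<close>; the new terminal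
    function is \<open>T v\<close>.\<close>
  define u where "u y = g (2*k+2) y * h y" for y
  have u[measurable]: "u \<in> borel_measurable borel" unfolding u_def by measurable
  have ub: "\<And>y. norm (u y) \<le> E * H"
    using g(2) Suc.prems(2)
    by (auto simp: u_def norm_mult intro!: mult_mono order_trans[OF norm_ge_zero g(2)])
  define v where "v y = g (2*k+1) y * T u y" for y
  note [measurable] = T_measurable[OF u]
  have v[measurable]: "v \<in> borel_measurable borel" unfolding v_def by measurable
  have vb: "\<And>y. norm (v y) \<le> E * (E * H)"
    using g(2) T_bound[OF u ub]
    by (auto simp: v_def norm_mult intro!: mult_mono order_trans[OF norm_ge_zero g(2)])
  have "(\<integral>\<omega>. (\<Prod>j=1..2*Suc k. g j (\<xi> j \<omega>)) * h (\<xi> (2*Suc k) \<omega>) \<partial>M)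
      = (\<integral>\<omega>. (\<Prod>j=1..2*k+1. g j (\<xi> j \<omega>)) * u (\<xi> (Suc (2*k+1)) \<omega>) \<partial>M)"
    by (simp add: u_def mult.assoc)
  also have "\<dots> = (\<integral>\<omega>. (\<Prod>j=1..2*k+1. g j (\<xi> j \<omega>)) * T u (\<xi> (2*k+1) \<omega>) \<partial>M)"
    by (rule markov_step_prod[OF g(1,2) u ub])
  also have "\<dots> = (\<integral>\<omega>. (\<Prod>j=1..2*k. g j (\<xi> j \<omega>)) * v (\<xi> (Suc (2*k)) \<omega>) \<partial>M)"
    by (simp add: v_def mult.assoc)
  also have "\<dots> = (\<integral>\<omega>. (\<Prod>j=1..2*k. g j (\<xi> j \<omega>)) * T v (\<xi> (2*k) \<omega>) \<partial>M)"
    by (rule markov_step_prod[OF g(1,2) v vb])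
  also have "norm \<dots> \<le> (\<rho> * E) ^ k * (\<rho> * (E * H))"
    unfolding \<rho>_def
  proof (rule Suc.IH)
    show "T v \<in> borel_measurable borel" by (rule T_measurable[OF v])
    show "norm (T v y) \<le> (q * (\<delta> * I) + (1 - q\<^sup>2) * E) * (E * H)" for y
      unfolding v_def by (rule T_T_bound[OF g(1) g(2) g(3) u ub])
  qed
  finally show ?case by (simp add: \<rho>_def mult_ac)
qed

text \<open>For even \<open>n\<close> the terminal function is the constant 1, bounded by
  \<open>E\<close>. For odd \<open>n\<close> the unpaired last factor becomes the terminal function
  after one Markov step.\<close>

lemma expectation_prod_bound:
  fixes g :: "nat \<Rightarrow> 'x \<Rightarrow> complex"
  assumes g: "\<And>j. g j \<in> borel_measurable borel" "\<And>j y. norm (g j y) \<le> E"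
      "\<And>j. norm (\<integral>y. g j y \<partial>vol) \<le> I"
    and E: "1 \<le> E" and \<rho>: "(q * (\<delta> * I) + (1 - q\<^sup>2) * E) * E \<le> \<rho>"
  shows "norm (\<integral>\<omega>. (\<Prod>j=1..n. g j (\<xi> j \<omega>)) \<partial>M) \<le> \<rho> ^ (n div 2) * E"
proof -
  define k where "k = n div 2"
  define L where "L = (q * (\<delta> * I) + (1 - q\<^sup>2) * E) * E"
  have "0 \<le> I" using g(3) norm_ge_zero order_trans by blast
  moreover have "q\<^sup>2 \<le> 1" using q by (intro power_le_one) auto
  ultimately have L0: "0 \<le> L" unfolding L_def using E q \<delta>(1) by simp
  have "norm (\<integral>\<omega>. (\<Prod>j=1..n. g j (\<xi> j \<omega>)) \<partial>M) \<le> L ^ k * E"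
  proof (cases "even n")
    case True
    then have n: "n = 2 * k" by (simp add: k_def)
    show ?thesis
      using expectation_prod_even_bound[OF g, where h = "\<lambda>_. 1" and H = E and k = k] E unfolding n L_def by simp
  next
    case False
    then have n: "n = Suc (2 * k)" by (simp add: k_def)
    have "(\<integral>\<omega>. (\<Prod>j=1..n. g j (\<xi> j \<omega>)) \<partial>M)
        = (\<integral>\<omega>. (\<Prod>j=1..2*k. g j (\<xi> j \<omega>)) * g (Suc (2*k)) (\<xi> (Suc (2*k)) \<omega>) \<partial>M)"
      by (simp add: n)
    also have "\<dots> = (\<integral>\<omega>. (\<Prod>j=1..2*k. g j (\<xi> j \<omega>)) * T (g (Suc (2*k))) (\<xi> (2*k) \<omega>) \<partial>M)"
      by (rule markov_step_prod[OF g(1,2) g(1,2)])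
    also have "norm \<dots> \<le> L ^ k * E"
      unfolding L_def
      by (rule expectation_prod_even_bound[OF g T_measurable[OF g(1)] T_bound[OF g(1) g(2)]])
    finally show ?thesis .
  qed
  also have "\<dots> \<le> \<rho> ^ k * E"
    using E \<rho> L0 by (intro mult_right_mono power_mono) (auto simp: L_def)
  finally show ?thesis by (simp add: k_def)
qed

end

subsection \<open>Derivatives of characteristic functions\<close>

text \<open>The exponential series without its constant term is compared term by term with the
  series at \<open>norm w\<close>.\<close>

lemma norm_exp_minus_one_le:
  fixes w :: complex
  shows "norm (exp w - 1) \<le> exp (norm w) - 1"
proof -
  have sm: "summable (\<lambda>n. norm w ^ Suc n /\<^sub>R fact (Suc n))"
    by (rule iffD2[OF summable_Suc_iff[of "\<lambda>n. norm w ^ n /\<^sub>R fact n"] summable_exp_generic])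
  have eq: "norm (w ^ Suc n /\<^sub>R fact (Suc n)) = norm w ^ Suc n /\<^sub>R fact (Suc n)" for n
    by (simp only: norm_scaleR norm_power abs_inverse abs_of_nonneg[OF fact_ge_zero] real_scaleR_def)
  have "norm (exp w - 1) = norm (\<Sum>n. w ^ Suc n /\<^sub>R fact (Suc n))"
    using exp_first_term[of w] by simp
  also have "\<dots> \<le> (\<Sum>n. norm (w ^ Suc n /\<^sub>R fact (Suc n)))"
    by (rule summable_norm) (use sm in \<open>simp only: eq\<close>)
  also have "\<dots> = exp (norm w) - 1"
    unfolding eq using exp_first_term[of "norm w"] by simp
  finally show ?thesis .
qed

lemma norm_exp_minus_one_le_mult: "norm (exp w - 1) \<le> norm w * exp (norm w)" for w :: complex
proof -
  have "1 + (- norm w) \<le> exp (- norm w)" by (rule exp_ge_add_one_self)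
  then have "(1 - norm w) * exp (norm w) \<le> exp (- norm w) * exp (norm w)"
    by (intro mult_right_mono) auto
  then have "exp (norm w) - 1 \<le> norm w * exp (norm w)"
    by (simp add: algebra_simps flip: exp_add)
  then show ?thesis using norm_exp_minus_one_le[of w] by linarith
qed

text \<open>Differentiation under the integral: since \<open>X\<close> is bounded, the difference
  quotients are dominated by a constant along every sequence of increments tending to 0.\<close>

lemma (in prob_space) complex_char_holomorphic:
  fixes X :: "'a \<Rightarrow> real"
  assumes [measurable]: "X \<in> borel_measurable M" and X: "\<And>\<omega>. \<bar>X \<omega>\<bar> \<le> C"
  shows "(\<lambda>z. \<integral>\<omega>. exp (\<i> * z * complex_of_real (X \<omega>)) \<partial>M) holomorphic_on UNIV"
proof -
  have C0: "0 \<le> C" using X abs_ge_zero order_trans by blast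
  define e where "e z \<omega> = exp (\<i> * z * complex_of_real (X \<omega>))" for z \<omega>
  have e_meas[measurable]: "e z \<in> borel_measurable M" for z unfolding e_def by measurable
  have e_bound: "norm (e z \<omega>) \<le> exp (norm z * C)" for z \<omega>
  proof -
    have "norm (e z \<omega>) \<le> exp (norm (\<i> * z * complex_of_real (X \<omega>)))" unfolding e_def by (rule norm_exp)
    also have "\<dots> \<le> exp (norm z * C)" using X by (simp add: norm_mult mult_left_mono)
    finally show ?thesis .
  qed
  have e_int: "integrable M (e z)" for z
    by (rule integrable_const_bound[of _ "exp (norm z * C)"]) (use e_bound in auto)
  have "((\<lambda>z. \<integral>\<omega>. e z \<omega> \<partial>M) has_field_derivative (\<integral>\<omega>. \<i> * complex_of_real (X \<omega>) * e z \<omega> \<partial>M)) (at z)" for z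
    unfolding DERIV_def tendsto_at_iff_sequentially
  proof (intro allI impI)
    fix h :: "nat \<Rightarrow> complex"
    assume h0: "\<forall>i. h i \<in> UNIV - {0}" and h: "h \<longlonglongrightarrow> 0"
    \<comment> \<open>A convergent sequence is bounded; \<open>K\<close> makes the dominating
      constant the same for all members of the sequence.\<close>
    obtain K where K: "K > 0" "\<And>i. norm (h i) \<le> K"
      using h by (metis Bseq_def convergentI convergent_imp_Bseq)
    have "(\<lambda>i. \<integral>\<omega>. (e (z + h i) \<omega> - e z \<omega>) / h i \<partial>M) \<longlonglongrightarrow> (\<integral>\<omega>. \<i> * complex_of_real (X \<omega>) * e z \<omega> \<partial>M)"
    proof (rule integral_dominated_convergence[where w = "\<lambda>_. exp (norm z * C) * (C * exp (K * C))"])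
      show "AE \<omega> in M. (\<lambda>i. (e (z + h i) \<omega> - e z \<omega>) / h i) \<longlonglongrightarrow> \<i> * complex_of_real (X \<omega>) * e z \<omega>"
      proof (rule AE_I2)
        fix \<omega>
        have "((\<lambda>z. e z \<omega>) has_field_derivative \<i> * complex_of_real (X \<omega>) * e z \<omega>) (at z)"
          unfolding e_def by (auto intro!: derivative_eq_intros)
        then show "(\<lambda>i. (e (z + h i) \<omega> - e z \<omega>) / h i) \<longlonglongrightarrow> \<i> * complex_of_real (X \<omega>) * e z \<omega>"
          unfolding DERIV_def tendsto_at_iff_sequentially using h0 h by (auto simp: o_def)
      qed
      show "AE \<omega> in M. norm ((e (z + h i) \<omega> - e z \<omega>) / h i) \<le> exp (norm z * C) * (C * exp (K * C))" for i
      proof (rule AE_I2)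
        fix \<omega>
        let ?w = "\<i> * h i * complex_of_real (X \<omega>)"
        have w: "norm ?w \<le> norm (h i) * C" using X by (simp add: norm_mult mult_left_mono)
        have "norm ?w \<le> K * C" using w K(2)[of i] C0 mult_right_mono order_trans by blast
        have "e (z + h i) \<omega> - e z \<omega> = e z \<omega> * (exp ?w - 1)"
          by (simp add: e_def algebra_simps exp_add)
        then have "norm (e (z + h i) \<omega> - e z \<omega>) = norm (e z \<omega>) * norm (exp ?w - 1)"
          by (simp add: norm_mult)
        also have "\<dots> \<le> exp (norm z * C) * (norm ?w * exp (norm ?w))"
          by (intro mult_mono e_bound norm_exp_minus_one_le_mult) auto
        also have "\<dots> \<le> exp (norm z * C) * ((norm (h i) * C) * exp (K * C))"
          using w \<open>norm ?w \<le> K * C\<close> C0 by (intro mult_left_mono mult_mono) auto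
        finally show "norm ((e (z + h i) \<omega> - e z \<omega>) / h i) \<le> exp (norm z * C) * (C * exp (K * C))"
          using h0 by (simp add: norm_divide divide_le_eq mult_ac)
      qed
    qed auto
    moreover have "(\<integral>\<omega>. (e (z + h i) \<omega> - e z \<omega>) / h i \<partial>M) = ((\<integral>\<omega>. e (z + h i) \<omega> \<partial>M) - (\<integral>\<omega>. e z \<omega> \<partial>M)) / h i" for i
      using e_int by simp
    ultimately show "((\<lambda>k. ((\<integral>\<omega>. e (z + k) \<omega> \<partial>M) - (\<integral>\<omega>. e z \<omega> \<partial>M)) / k) \<circ> h)
        \<longlonglongrightarrow> (\<integral>\<omega>. \<i> * complex_of_real (X \<omega>) * e z \<omega> \<partial>M)"
      by (simp only: o_def)
  qed
  then have "(\<lambda>z. \<integral>\<omega>. e z \<omega> \<partial>M) holomorphic_on UNIV"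
    by (auto simp: holomorphic_on_open)
  then show ?thesis by (simp add: e_def)
qed

text \<open>Derivatives along the real line are complex derivatives of the entire extension, which
  is what makes Cauchy's inequality applicable to them. Each differentiation contributes a factor
  \<open>1 / a\<close>.\<close>

lemma nth_derivative_of_real_rescaled:
  fixes \<phi> :: "complex \<Rightarrow> complex"
  assumes \<phi>: "\<phi> holomorphic_on UNIV"
  shows "nth_derivative m (\<lambda>t. \<phi> (of_real (t / a))) = (\<lambda>t. (deriv ^^ m) \<phi> (of_real (t / a)) / of_real a ^ m)"
proof (induction m)
  case (Suc m)
  have hol: "(deriv ^^ m) \<phi> holomorphic_on UNIV" by (rule holomorphic_higher_deriv[OF \<phi> open_UNIV])
  show ?case
  proof
    fix t
    have "((deriv ^^ m) \<phi> has_field_derivative (deriv ^^ Suc m) \<phi> (of_real t / of_real a)) (at (of_real t / of_real a))"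
      using holomorphic_derivI[OF hol open_UNIV] by simp
    then have "((\<lambda>z. (deriv ^^ m) \<phi> (z / of_real a) / of_real a ^ m) has_field_derivative
        (deriv ^^ Suc m) \<phi> (of_real t / of_real a) * (1 / of_real a) / of_real a ^ m) (at (of_real t))"
      by (intro DERIV_cdivide DERIV_chain2[where f = "(deriv ^^ m) \<phi>"]) (auto intro!: derivative_eq_intros)
    then have "((\<lambda>t. (deriv ^^ m) \<phi> (of_real t / of_real a) / of_real a ^ m) has_vector_derivative
        (deriv ^^ Suc m) \<phi> (of_real t / of_real a) * (1 / of_real a) / of_real a ^ m) (at t)"
      by (rule has_vector_derivative_real_field)
    then have "vector_derivative (\<lambda>t. (deriv ^^ m) \<phi> (of_real (t / a)) / of_real a ^ m) (at t)
        = (deriv ^^ Suc m) \<phi> (of_real (t / a)) / of_real a ^ Suc m"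
      by (subst vector_derivative_at) (auto simp: field_simps)
    then show "nth_derivative (Suc m) (\<lambda>t. \<phi> (of_real (t / a))) t = (deriv ^^ Suc m) \<phi> (of_real (t / a)) / of_real a ^ Suc m"
      using Suc.IH by (simp add: nth_derivative_def)
  qed
qed (simp add: nth_derivative_def)

lemma tendsto_powr_exp_neg_powr:
  fixes a b K :: real
  assumes "b > 0" "K > 0"
  shows "(\<lambda>n::nat. real n powr a * exp (- K * real n powr b)) \<longlonglongrightarrow> 0"
  using assms by real_asymp

section \<open>The characteristic function of the centred sum near a real frequency\<close>

context doeblin_chain
begin

text \<open>The exponential of the sum is a product of one factor per step. At the real frequency
  \<open>s\<close> each factor has modulus 1 and integral at most
  \<open>measure vol UNIV - \<eta>\<close> in modulus, so two steps gain
  \<open>\<epsilon> = q * \<delta> * \<eta>\<close>. The disc is so small that the growth of the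
  moduli off the real line consumes at most half of this gain.\<close>

lemma expectation_exp_bound:
  fixes f :: "'x \<Rightarrow> real" and a :: "nat \<Rightarrow> real" and s \<eta> :: real
  assumes f[measurable]: "f \<in> borel_measurable borel" and F: "F > 0" "\<And>x. \<bar>f x\<bar> \<le> F" "\<And>j. \<bar>a j\<bar> \<le> F"
    and \<eta>: "0 < \<eta>" "norm (\<integral>x. cis (s * f x) \<partial>vol) \<le> measure vol UNIV - \<eta>"
    and z: "norm (z - of_real s) \<le> q * \<delta> * \<eta> / (16 * F)"
  shows "norm (\<integral>\<omega>. exp (\<i> * z * of_real (\<Sum>j=1..n. f (\<xi> j \<omega>) - a j)) \<partial>M)
    \<le> 2 * (1 - q * \<delta> * \<eta> / 2) ^ (n div 2)"
proof -
  define m where "m = measure vol UNIV"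
  define \<epsilon> where "\<epsilon> = q * \<delta> * \<eta>"
  have \<eta>m: "\<eta> \<le> m" using \<eta>(2) norm_ge_zero[of "\<integral>x. cis (s * f x) \<partial>vol"] unfolding m_def by linarith
  have "\<delta> * \<eta> \<le> q" using mult_left_mono[OF \<eta>m less_imp_le[OF \<delta>(1)]] by (simp add: m_def)
  then have \<delta>\<eta>: "\<delta> * \<eta> \<le> 1" using q(2) by linarith
  then have \<epsilon>: "0 < \<epsilon>" "\<epsilon> \<le> 1"
  proof -
    have "0 < q * (\<delta> * \<eta>)" by (rule mult_pos_pos[OF q(1) mult_pos_pos[OF \<delta>(1) \<eta>(1)]])
    then show "0 < \<epsilon>" unfolding \<epsilon>_def by (simp only: mult.assoc)
    have "q * (\<delta> * \<eta>) \<le> 1 * 1" using q \<delta>(1) \<eta>(1) \<delta>\<eta> by (intro mult_mono) simp_all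
    then show "\<epsilon> \<le> 1" unfolding \<epsilon>_def by (simp only: mult.assoc mult_1)
  qed
  define w where "w = z - of_real s"
  \<comment> \<open>On the disc \<open>norm w \<le> \<epsilon> / (16 * F)\<close> and
    \<open>\<bar>f y - a j\<bar> \<le> 2 * F\<close>, so the perturbing exponent has size at most
    \<open>\<epsilon> / 8\<close>.\<close>
  define E where "E = exp (\<epsilon> / 8)"
  have E1: "1 \<le> E" using \<epsilon> by (simp add: E_def)
  have E2: "E * E \<le> 1 + \<epsilon> / 2"
  proof -
    have "E * E = exp (\<epsilon> / 4)" by (simp add: E_def flip: exp_add)
    also have "\<dots> \<le> 1 + \<epsilon> / 4 + (\<epsilon> / 4)\<^sup>2" using \<epsilon> by (intro exp_bound) auto
    also have "(\<epsilon> / 4)\<^sup>2 \<le> \<epsilon> / 4" using \<epsilon> by (simp add: power2_eq_square mult_left_le)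
    finally show ?thesis by simp
  qed
  have "E \<le> E * E" using E1 by simp
  then have E3: "E \<le> 2" using E2 \<epsilon> by linarith
  define g where "g j y = exp (\<i> * z * complex_of_real (f y - a j))" for j y
  have g_meas[measurable]: "g j \<in> borel_measurable borel" for j unfolding g_def by measurable
  have fa: "\<bar>f y - a j\<bar> \<le> 2 * F" for y j using F(2)[of y] F(3)[of j] by linarith
  have split: "g j y = cis (s * (f y - a j)) * exp (\<i> * w * complex_of_real (f y - a j))" for j y
    by (simp add: g_def w_def cis_conv_exp algebra_simps flip: exp_add)
  have w: "norm (\<i> * w * complex_of_real (f y - a j)) \<le> \<epsilon> / 8" for j y
  proof -
    have "norm (\<i> * w * complex_of_real (f y - a j)) = norm w * \<bar>f y - a j\<bar>"
      by (simp only: norm_mult norm_of_real norm_ii mult_1)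
    also have "\<dots> \<le> (\<epsilon> / (16 * F)) * (2 * F)"
      using z fa[of y j] \<epsilon> F(1) by (intro mult_mono) (auto simp: w_def \<epsilon>_def)
    also have "\<dots> = \<epsilon> / 8" using F(1) by simp
    finally show ?thesis .
  qed
  have g_bound: "norm (g j y) \<le> E" for j y
  proof -
    have "norm (g j y) = norm (exp (\<i> * w * complex_of_real (f y - a j)))"
      by (simp only: split norm_mult norm_cis mult_1)
    also have "\<dots> \<le> exp (norm (\<i> * w * complex_of_real (f y - a j)))" by (rule norm_exp)
    also have "\<dots> \<le> E" using w by (simp add: E_def)
    finally show ?thesis .
  qed
  have [measurable]: "cis \<in> borel_measurable borel"
    by (intro borel_measurable_continuous_onI continuous_on_cis continuous_on_id)
  have g_int: "norm (\<integral>y. g j y \<partial>vol) \<le> E * m - \<eta>" for j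
  proof -
    \<comment> \<open>\<open>d\<close> is the deviation from the unimodular factor at the real
      frequency. It is at most \<open>E - 1\<close> pointwise, so it adds at most
      \<open>(E - 1) * m\<close> to the integral.\<close>
    define d where "d y = g j y - cis (s * (f y - a j))" for y
    have d_meas: "d \<in> borel_measurable borel" unfolding d_def by measurable
    have d_bound: "norm (d y) \<le> E - 1" for y
    proof -
      have "d y = cis (s * (f y - a j)) * (exp (\<i> * w * complex_of_real (f y - a j)) - 1)"
        by (simp add: d_def split algebra_simps)
      then have "norm (d y) = norm (exp (\<i> * w * complex_of_real (f y - a j)) - 1)"
        by (simp only: norm_mult norm_cis mult_1)
      also have "\<dots> \<le> exp (norm (\<i> * w * complex_of_real (f y - a j))) - 1" by (rule norm_exp_minus_one_le)
      also have "\<dots> \<le> E - 1" using w by (simp add: E_def)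
      finally show ?thesis .
    qed
    have di: "integrable vol d" by (rule bounded_integrable[OF d_meas d_bound])
    have c_meas: "(\<lambda>y. cis (s * f y)) \<in> borel_measurable borel" by measurable
    have ci: "integrable vol (\<lambda>y. cis (s * f y))"
      by (rule bounded_integrable[OF c_meas, of 1]) simp
    have "(\<integral>y. g j y \<partial>vol) = (\<integral>y. cis (- s * a j) * cis (s * f y) + d y \<partial>vol)"
      by (simp add: d_def cis_mult algebra_simps)
    also have "\<dots> = cis (- s * a j) * (\<integral>y. cis (s * f y) \<partial>vol) + (\<integral>y. d y \<partial>vol)"
      using di ci by simp
    finally have "norm (\<integral>y. g j y \<partial>vol) \<le> norm (\<integral>y. cis (s * f y) \<partial>vol) + norm (\<integral>y. d y \<partial>vol)"
      by (metis norm_triangle_ineq norm_mult norm_cis mult_1)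
    moreover have "norm (\<integral>y. d y \<partial>vol) \<le> (\<integral>y. E - 1 \<partial>vol)"
      by (rule order_trans[OF integral_norm_bound])
        (intro integral_mono, use di d_bound in auto)
    ultimately show ?thesis using \<eta>(2) by (simp add: space_vol m_def algebra_simps)
  qed
  \<comment> \<open>Since \<open>\<delta> * m = q\<close>, the terms with \<open>q\<^sup>2\<close>
    cancel and the two-step factor becomes \<open>(E - \<epsilon>) * E\<close>.\<close>
  have "(q * (\<delta> * (E * m - \<eta>)) + (1 - q\<^sup>2) * E) * E = E * E - \<epsilon> * E"
    by (simp add: \<epsilon>_def m_def algebra_simps power2_eq_square)
  also have "\<dots> \<le> 1 - \<epsilon> / 2"
    using E2 mult_left_mono[OF E1 less_imp_le[OF \<epsilon>(1)]] by linarith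
  finally have "norm (\<integral>\<omega>. (\<Prod>j=1..n. g j (\<xi> j \<omega>)) \<partial>M) \<le> (1 - \<epsilon> / 2) ^ (n div 2) * E"
    by (intro expectation_prod_bound[OF g_meas g_bound g_int E1])
  also have "\<dots> \<le> (1 - \<epsilon> / 2) ^ (n div 2) * 2"
    using E3 \<epsilon> by (intro mult_left_mono) auto
  also have "(\<integral>\<omega>. (\<Prod>j=1..n. g j (\<xi> j \<omega>)) \<partial>M)
      = (\<integral>\<omega>. exp (\<i> * z * of_real (\<Sum>j=1..n. f (\<xi> j \<omega>) - a j)) \<partial>M)"
    unfolding g_def by (simp only: exp_sum[OF finite_atLeastAtMost, symmetric] sum_distrib_left[symmetric] of_real_sum[symmetric])
  finally show ?thesis by (simp add: \<epsilon>_def mult.commute)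
qed

lemma centered_sum_props:
  fixes f :: "'x \<Rightarrow> real"
  assumes f[measurable]: "f \<in> borel_measurable borel" and F: "\<And>x. \<bar>f x\<bar> \<le> F"
  shows "\<bar>P.expectation (\<lambda>\<omega>. f (\<xi> j \<omega>))\<bar> \<le> F"
    and "centered_sum M \<xi> f n \<in> borel_measurable M"
    and "\<bar>centered_sum M \<xi> f n \<omega>\<bar> \<le> 2 * F * n"
    and "P.variance (centered_sum M \<xi> f n) = (L2_norm M (centered_sum M \<xi> f n))\<^sup>2"
proof -
  have int: "integrable M (\<lambda>\<omega>. f (\<xi> j \<omega>))" for j
    by (rule P.integrable_const_bound[of _ F]) (use F in auto)
  show exp_bound: "\<bar>P.expectation (\<lambda>\<omega>. f (\<xi> j \<omega>))\<bar> \<le> F" for j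
  proof -
    have "\<bar>P.expectation (\<lambda>\<omega>. f (\<xi> j \<omega>))\<bar> \<le> (\<integral>\<omega>. \<bar>f (\<xi> j \<omega>)\<bar> \<partial>M)" by (rule integral_abs_bound)
    also have "\<dots> \<le> (\<integral>\<omega>. F \<partial>M)" by (intro integral_mono) (use int F in auto)
    finally show ?thesis by (simp add: P.prob_space)
  qed
  show "centered_sum M \<xi> f n \<in> borel_measurable M"
    unfolding centered_sum_def by measurable
  have "\<bar>centered_sum M \<xi> f n \<omega>\<bar> \<le> (\<Sum>j=1..n. 2 * F)" for \<omega>
    unfolding centered_sum_def
  proof (rule order_trans[OF sum_abs], rule sum_mono)
    fix j
    show "\<bar>f (\<xi> j \<omega>) - P.expectation (\<lambda>\<omega>. f (\<xi> j \<omega>))\<bar> \<le> 2 * F"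
      using F[of "\<xi> j \<omega>"] exp_bound[of j] by linarith
  qed
  then show "\<bar>centered_sum M \<xi> f n \<omega>\<bar> \<le> 2 * F * n" for \<omega> by (simp add: mult.commute)
  have "P.expectation (centered_sum M \<xi> f n) = 0"
    unfolding centered_sum_def using int by (simp add: P.prob_space)
  then show "P.variance (centered_sum M \<xi> f n) = (L2_norm M (centered_sum M \<xi> f n))\<^sup>2"
    by (simp add: L2_norm_def)
qed

text \<open>Cauchy's inequality is applied on the disc of radius \<open>r\<close> around
  \<open>t / \<sigma>\<close>, the disc on which \<open>expectation_exp_bound\<close> holds. The
  powers of \<open>1 / r\<close> and \<open>1 / \<sigma>\<close> come from the radius and from the
  rescaling.\<close>

lemma nth_derivative_normalized_char_bound:
  fixes f :: "'x \<Rightarrow> real" and \<eta> :: real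
  assumes f[measurable]: "f \<in> borel_measurable borel" and F: "F > 0" "\<And>x. \<bar>f x\<bar> \<le> F"
    and \<sigma>: "\<sigma> = L2_norm M (centered_sum M \<xi> f n)" "\<sigma> > 0"
    and \<eta>: "0 < \<eta>" "norm (\<integral>x. cis (t / \<sigma> * f x) \<partial>vol) \<le> measure vol UNIV - \<eta>"
  shows "norm (nth_derivative m (normalized_char M (centered_sum M \<xi> f) n) t)
    \<le> fact m * (2 * (1 - q * \<delta> * \<eta> / 2) ^ (n div 2)) * (16 * F / (q * \<delta> * \<eta>)) ^ m / \<sigma> ^ m"
proof -
  define S where "S = centered_sum M \<xi> f n"
  define \<phi> where "\<phi> z = (\<integral>\<omega>. exp (\<i> * z * complex_of_real (S \<omega>)) \<partial>M)" for z
  define r where "r = q * \<delta> * \<eta> / (16 * F)"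
  have r: "r > 0" using q \<delta>(1) \<eta>(1) F(1) by (simp add: r_def)
  note props = centered_sum_props[OF f F(2)]
  have hol: "\<phi> holomorphic_on UNIV"
    unfolding \<phi>_def S_def using props(2,3) by (rule P.complex_char_holomorphic)
  have "normalized_char M (centered_sum M \<xi> f) n = (\<lambda>t. \<phi> (of_real (t / \<sigma>)))"
    by (simp add: normalized_char_def \<phi>_def S_def \<sigma>(1) fun_eq_iff mult.assoc)
  then have "norm (nth_derivative m (normalized_char M (centered_sum M \<xi> f) n) t)
      = norm ((deriv ^^ m) \<phi> (of_real (t / \<sigma>))) / \<sigma> ^ m"
    by (simp only: nth_derivative_of_real_rescaled[OF hol] norm_divide norm_power norm_of_real abs_of_pos[OF \<sigma>(2)])
  also have "norm ((deriv ^^ m) \<phi> (of_real (t / \<sigma>))) \<le> fact m * (2 * (1 - q * \<delta> * \<eta> / 2) ^ (n div 2)) / r ^ m"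
  proof (rule Cauchy_inequality)
    show "\<phi> holomorphic_on ball (of_real (t / \<sigma>)) r" using hol holomorphic_on_subset by blast
    show "continuous_on (cball (of_real (t / \<sigma>)) r) \<phi>"
      using hol holomorphic_on_imp_continuous_on continuous_on_subset by blast
    fix z :: complex assume "norm (of_real (t / \<sigma>) - z) = r"
    then have "norm (z - of_real (t / \<sigma>)) \<le> q * \<delta> * \<eta> / (16 * F)" by (simp add: norm_minus_commute r_def)
    then show "norm (\<phi> z) \<le> 2 * (1 - q * \<delta> * \<eta> / 2) ^ (n div 2)"
      unfolding \<phi>_def S_def centered_sum_def
      by (rule expectation_exp_bound[OF f F(1,2) props(1) \<eta>])
  qed (rule r)
  also have "\<dots> = fact m * (2 * (1 - q * \<delta> * \<eta> / 2) ^ (n div 2)) * (16 * F / (q * \<delta> * \<eta>)) ^ m"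
    by (simp add: r_def power_divide)
  finally show ?thesis using \<sigma>(2) by (simp add: divide_right_mono)
qed

end

subsection \<open>Asymptotics\<close>

context doeblin_chain
begin

text \<open>One gap \<open>\<eta>\<close> serves the whole range of frequencies, so the integrand
  has a constant bound \<open>K\<close>, and the domain lies in an interval of length
  \<open>2 * b\<close>. The factor \<open>1 / \<bar>t\<bar>\<close> is at most \<open>1 / c\<close>
  because \<open>\<sigma> \<ge> 1\<close>.\<close>

lemma normalized_char_integral_bound:
  fixes f :: "'x \<Rightarrow> real" and \<sigma> \<eta> b :: real
  assumes f: "f \<in> borel_measurable borel" and F: "F > 0" "\<And>x. \<bar>f x\<bar> \<le> F"
    and \<sigma>: "\<sigma> = L2_norm M (centered_sum M \<xi> f n)" "\<sigma> \<ge> 1" and c: "c > 0" and b: "b \<ge> 0"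
    and \<eta>: "0 < \<eta>" "q * \<delta> * \<eta> \<le> 1"
      "\<And>s. c \<le> \<bar>s\<bar> \<Longrightarrow> \<bar>s\<bar> \<le> b / \<sigma> \<Longrightarrow> norm (\<integral>x. cis (s * f x) \<partial>vol) \<le> measure vol UNIV - \<eta>"
  shows "\<bar>LBINT t:{t. c * \<sigma> \<le> \<bar>t\<bar> \<and> \<bar>t\<bar> \<le> b}.
      cmod (nth_derivative m (normalized_char M (centered_sum M \<xi> f) n) t / complex_of_real t)\<bar>
    \<le> 4 * b / c * fact m * (16 * F / (q * \<delta> * \<eta>)) ^ m * exp (- (q * \<delta> * \<eta> / 2) * real (n div 2))"
    (is "\<bar>?I\<bar> \<le> _")
proof -
  define D where "D = {t. c * \<sigma> \<le> \<bar>t\<bar> \<and> \<bar>t\<bar> \<le> b}"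
  define h where "h t = cmod (nth_derivative m (normalized_char M (centered_sum M \<xi> f) n) t / complex_of_real t)" for t
  define Q where "Q = q * \<delta> * \<eta>"
  define e where "e = exp (- (Q / 2) * real (n div 2))"
  define K where "K = 2 / c * fact m * (16 * F / Q) ^ m * e"
  have Q: "0 < Q" "Q \<le> 1" using mult_pos_pos[OF mult_pos_pos[OF q(1) \<delta>(1)] \<eta>(1)] \<eta>(2) by (auto simp: Q_def)
  have pow: "(1 - Q / 2) ^ (n div 2) \<le> e"
  proof -
    have "(1 - Q / 2) ^ (n div 2) \<le> exp (- (Q / 2)) ^ (n div 2)"
      using exp_ge_add_one_self[of "- (Q / 2)"] Q by (intro power_mono) auto
    also have "\<dots> = e" by (simp add: e_def mult.commute flip: exp_of_nat_mult)
    finally show ?thesis .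
  qed
  have K0: "0 \<le> K" using c F(1) Q by (simp add: K_def e_def)
  have h: "h t \<le> K" if t: "t \<in> D" for t
  proof -
    have s: "\<bar>t / \<sigma>\<bar> \<ge> c" "\<bar>t / \<sigma>\<bar> \<le> b / \<sigma>"
      using t \<sigma>(2) by (auto simp: D_def field_simps)
    have c\<sigma>: "c * 1 \<le> c * \<sigma>" using \<sigma>(2) c by (intro mult_left_mono) auto
    then have t1: "c \<le> \<bar>t\<bar>" using t by (simp add: D_def)
    have \<sigma>0: "\<sigma> > 0" using \<sigma>(2) by simp
    have "norm (nth_derivative m (normalized_char M (centered_sum M \<xi> f) n) t)
        \<le> fact m * (2 * (1 - Q / 2) ^ (n div 2)) * (16 * F / Q) ^ m / \<sigma> ^ m"
      unfolding Q_def using nth_derivative_normalized_char_bound[OF f F \<sigma>(1) \<sigma>0 \<eta>(1) \<eta>(3)[OF s]] .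
    also have "\<dots> \<le> fact m * (2 * e) * (16 * F / Q) ^ m / 1"
      using pow Q F(1) \<sigma>(2) by (intro frac_le mult_right_mono mult_left_mono mult_nonneg_nonneg) (auto simp: e_def)
    finally have "norm (nth_derivative m (normalized_char M (centered_sum M \<xi> f) n) t)
      \<le> fact m * (2 * e) * (16 * F / Q) ^ m" by simp
    then have "h t \<le> fact m * (2 * e) * (16 * F / Q) ^ m / c"
      unfolding h_def norm_divide norm_of_real using t1 c Q(1) F(1) by (intro frac_le) (auto simp: e_def)
    then show ?thesis by (simp add: K_def mult_ac)
  qed
  have "?I = (\<integral>t. indicator D t * h t \<partial>lborel)"
    by (simp add: set_lebesgue_integral_def D_def h_def)
  \<comment> \<open>\<open>integral_mono'\<close> asks for integrability of the constant majorant
    only.\<close>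
  also have "\<dots> \<le> (\<integral>t. indicator {-b..b} t * K \<partial>lborel)"
  proof (rule integral_mono')
    show "integrable lborel (\<lambda>t. indicator {-b..b} t * K)"
      by (intro integrable_mult_left integrable_real_indicator) (use b in simp_all)
    show "indicator D t * h t \<le> indicator {-b..b} t * K" for t
      using h[of t] K0 by (auto simp: indicator_def D_def)
    show "0 \<le> indicator {-b..b} t * K" for t using K0 by simp
  qed
  also have "\<dots> = 2 * b * K" using b by simp
  finally have "?I \<le> 2 * b * K" .
  moreover have "0 \<le> ?I"
    unfolding set_lebesgue_integral_def by (rule integral_nonneg_AE) simp
  ultimately show ?thesis by (simp add: K_def Q_def e_def mult_ac)
qed

text \<open>On the range of integration \<open>\<bar>t\<bar> / \<sigma> n\<close> is at most
  \<open>B * \<sigma> n ^ (m - 3)\<close>, hence of order at most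
  \<open>n powr ((m - 3) / 2)\<close>, so the gap is at least a multiple of
  \<open>n powr (- \<gamma>)\<close>. After \<open>n div 2\<close> double steps this gives
  \<open>exp (- const * n powr (1 - \<gamma>))\<close>, which beats every power of \<open>n\<close>
  because \<open>\<gamma> < 1\<close>.\<close>

lemma normalized_char_integral_smallo:
  fixes f :: "'x \<Rightarrow> real" and \<sigma> :: "nat \<Rightarrow> real"
  assumes f: "f \<in> borel_measurable borel" and F: "F > 0" "\<And>x. \<bar>f x\<bar> \<le> F"
    and \<sigma>: "\<sigma> = (\<lambda>n. L2_norm M (centered_sum M \<xi> f n))"
    and decay: "\<kappa> > 0" "\<beta> \<ge> 0"
      "\<And>s. c \<le> \<bar>s\<bar> \<Longrightarrow> norm (\<integral>x. cis (s * f x) \<partial>vol) \<le> measure vol UNIV - \<kappa> * \<bar>s\<bar> powr (- \<beta>)"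
    and V: "(\<lambda>n. P.variance (centered_sum M \<xi> f n) / real n) \<longlonglongrightarrow> V" "V > 0"
    and m: "m \<ge> 3" "\<beta> * (real m - 3) / 2 < 1" and c: "c > 0" and B: "B > 0"
  shows "(\<lambda>n. LBINT t:{t. c * \<sigma> n \<le> \<bar>t\<bar> \<and> \<bar>t\<bar> \<le> B * \<sigma> n ^ (m - 2)}.
      cmod (nth_derivative m (normalized_char M (centered_sum M \<xi> f) n) t / complex_of_real t))
    \<in> o(\<lambda>n. 1 / \<sigma> n ^ (m - 2))" (is "?I \<in> _")
proof -
  define \<gamma> where "\<gamma> = \<beta> * (real m - 3) / 2"
  \<comment> \<open>The first entry of the minimum keeps \<open>\<eta> n\<close> below the gap at
    the largest frequency, the second ensures
    \<open>q * \<delta> * \<eta> n \<le> 1\<close>.\<close>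
  define K0 where "K0 = min (\<kappa> * (B * (2 * V) powr ((real m - 3) / 2)) powr (- \<beta>)) (1 / (q * \<delta>))"
  define \<eta> where "\<eta> n = K0 * real n powr (- \<gamma>)" for n :: nat
  define Q where "Q = q * \<delta> * K0"
  have q\<delta>: "0 < q * \<delta>" by (rule mult_pos_pos[OF q(1) \<delta>(1)])
  have mult_inverse: "x * (1 / x) = 1" if "0 < x" for x :: real using that by simp
  have K0: "0 < K0" unfolding K0_def min_less_iff_conj using q\<delta> decay(1) B V(2) by auto
  have Q: "0 < Q" "Q \<le> 1"
  proof -
    show "0 < Q" unfolding Q_def by (rule mult_pos_pos[OF q\<delta> K0])
    have "Q \<le> q * \<delta> * (1 / (q * \<delta>))"
      unfolding Q_def using q\<delta> by (intro mult_left_mono) (auto simp: K0_def)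
    also have "\<dots> = 1" by (rule mult_inverse[OF q\<delta>])
    finally show "Q \<le> 1" .
  qed
  have \<gamma>: "0 \<le> \<gamma>" "\<gamma> < 1" using decay(2) m by (auto simp: \<gamma>_def)
  note props = centered_sum_props[OF f F(2)]
  have lim: "(\<lambda>n. (\<sigma> n)\<^sup>2 / real n) \<longlonglongrightarrow> V" using V(1) unfolding props(4) \<sigma> .
  have ev: "\<forall>\<^sub>F n in sequentially. V / 2 < (\<sigma> n)\<^sup>2 / real n" "\<forall>\<^sub>F n in sequentially. (\<sigma> n)\<^sup>2 / real n < 2 * V"
    by (rule order_tendstoD(1)[OF lim], use V(2) in simp) (rule order_tendstoD(2)[OF lim], use V(2) in simp)
  \<comment> \<open>Together with the lower variance bound, \<open>n \<ge> 2 / V\<close> gives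
    \<open>\<sigma> n \<ge> 1\<close>; \<open>n \<ge> 2\<close> is needed when \<open>n\<close> is
    compared with \<open>n div 2\<close>.\<close>
  have ev2: "\<forall>\<^sub>F n in sequentially. real n \<ge> max 2 (2 / V)"
    using filterlim_real_sequentially unfolding filterlim_at_top by blast
  have \<sigma>_nonneg: "\<sigma> n \<ge> 0" for n by (simp add: \<sigma> L2_norm_def)
  define W where "W n = 4 * B / c * fact m * (2 * V) ^ m * (16 * F / Q) ^ m *
    (real n powr (real m + \<gamma> * real m) * exp (- (Q / 8) * real n powr (1 - \<gamma>)))" for n :: nat
  have main: "\<forall>\<^sub>F n in sequentially. \<sigma> n > 0 \<and> norm (?I n / (1 / \<sigma> n ^ (m - 2))) \<le> W n"
    using ev ev2
  proof eventually_elim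
    case (elim n)
    then have n: "real n > 0" "n \<ge> 2" "real n \<ge> 2 / V" by auto
    have \<sigma>2: "V / 2 * n < (\<sigma> n)\<^sup>2" "(\<sigma> n)\<^sup>2 < 2 * V * n"
      using elim n by (auto simp: field_simps)
    have "1 \<le> V / 2 * n" using n V(2) by (simp add: field_simps)
    then have "1 \<le> (\<sigma> n)\<^sup>2" using \<sigma>2 by linarith
    then have \<sigma>1: "1 \<le> \<sigma> n" using \<sigma>_nonneg[of n] by (simp add: abs_square_le_1 power2_nonneg_ge_1_iff)
    have \<sigma>k: "\<sigma> n ^ (m - 3) \<le> (2 * V * n) powr ((real m - 3) / 2)"
    proof -
      have "\<sigma> n ^ (m - 3) = \<sigma> n powr (real m - 3)"
        using \<sigma>1 m(1) by (simp add: of_nat_diff flip: powr_realpow)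
      also have "\<dots> = ((\<sigma> n)\<^sup>2) powr ((real m - 3) / 2)"
      proof -
        have "2 * ((real m - 3) / 2) = real m - 3" by simp
        then show ?thesis using \<sigma>1 powr_powr[of "\<sigma> n" 2 "(real m - 3) / 2"] by (simp only: powr_numeral)
      qed
      also have "\<dots> \<le> (2 * V * n) powr ((real m - 3) / 2)"
        using \<sigma>2 m(1) by (intro powr_mono2) auto
      finally show ?thesis .
    qed
    have \<eta>n: "0 < \<eta> n" using K0 n by (simp add: \<eta>_def)
    have Q\<eta>: "q * \<delta> * \<eta> n = Q * real n powr (- \<gamma>)" by (simp add: Q_def \<eta>_def)
    have "real n powr (- \<gamma>) \<le> real n powr 0" using n \<gamma> by (intro powr_mono) auto
    then have Q\<eta>1: "q * \<delta> * \<eta> n \<le> 1" unfolding Q\<eta> using Q n mult_mono[of Q 1 "real n powr (- \<gamma>)" 1] by simp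
    have \<eta>_le: "norm (\<integral>x. cis (s * f x) \<partial>vol) \<le> measure vol UNIV - \<eta> n"
      if s: "c \<le> \<bar>s\<bar>" "\<bar>s\<bar> \<le> B * \<sigma> n ^ (m - 2) / \<sigma> n" for s
    proof -
      have "m - 2 = Suc (m - 3)" using m(1) by simp
      then have "\<bar>s\<bar> \<le> B * \<sigma> n ^ (m - 3)" using s(2) \<sigma>1 by simp
      also have "\<dots> \<le> B * (2 * V * n) powr ((real m - 3) / 2)" using \<sigma>k B by simp
      also have "\<dots> = (B * (2 * V) powr ((real m - 3) / 2)) * n powr ((real m - 3) / 2)"
        using V(2) by (simp add: powr_mult)
      \<comment> \<open>The exponent is nonpositive, so the upper bound for
        \<open>\<bar>s\<bar>\<close> turns into a lower bound for the gap.\<close>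
      finally have "\<bar>s\<bar> powr (- \<beta>) \<ge> ((B * (2 * V) powr ((real m - 3) / 2)) * n powr ((real m - 3) / 2)) powr (- \<beta>)"
        using s(1) c decay(2) by (intro powr_mono2') auto
      also have "((B * (2 * V) powr ((real m - 3) / 2)) * n powr ((real m - 3) / 2)) powr (- \<beta>)
          = (B * (2 * V) powr ((real m - 3) / 2)) powr (- \<beta>) * real n powr (- \<gamma>)"
        using B by (simp add: powr_mult powr_powr \<gamma>_def mult_ac)
      finally have "\<kappa> * ((B * (2 * V) powr ((real m - 3) / 2)) powr (- \<beta>) * real n powr (- \<gamma>)) \<le> \<kappa> * \<bar>s\<bar> powr (- \<beta>)"
        using decay(1) by (intro mult_left_mono) auto
      moreover have "\<eta> n \<le> \<kappa> * (B * (2 * V) powr ((real m - 3) / 2)) powr (- \<beta>) * real n powr (- \<gamma>)"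
        unfolding \<eta>_def by (intro mult_right_mono) (auto simp: K0_def)
      ultimately show ?thesis using decay(3)[OF s(1)] by (simp add: mult.assoc)
    qed
    have bnn: "0 \<le> B * \<sigma> n ^ (m - 2)" using B \<sigma>1 by simp
    have \<sigma>n: "\<sigma> n = L2_norm M (centered_sum M \<xi> f n)" by (simp add: \<sigma>)
    \<comment> \<open>One power comes from the length of the range of integration, the other from
      the claimed rate. Any polynomial bound in \<open>n\<close> suffices, so the exponents are
      raised to \<open>m\<close>.\<close>
    have "\<sigma> n ^ (m - 2) * \<sigma> n ^ (m - 2) \<le> \<sigma> n ^ m * \<sigma> n ^ m"
      using \<sigma>1 by (intro mult_mono power_increasing) auto
    also have "\<dots> = ((\<sigma> n)\<^sup>2) ^ m" by (simp add: power2_eq_square power_mult_distrib)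
    also have "\<dots> \<le> (2 * V * n) ^ m" using \<sigma>2 by (intro power_mono) auto
    also have "\<dots> = (2 * V) ^ m * real n powr real m" using n by (simp add: power_mult_distrib powr_realpow)
    finally have b1: "\<sigma> n ^ (m - 2) * \<sigma> n ^ (m - 2) \<le> (2 * V) ^ m * real n powr real m" .
    have "16 * F / (q * \<delta> * \<eta> n) = 16 * F / Q * real n powr \<gamma>"
      unfolding Q\<eta> using n by (simp add: powr_minus field_simps)
    then have "(16 * F / (q * \<delta> * \<eta> n)) ^ m = (16 * F / Q) ^ m * (real n powr \<gamma>) ^ m"
      by (simp only: power_mult_distrib)
    also have "(real n powr \<gamma>) ^ m = real n powr (\<gamma> * real m)" using n by (simp add: powr_powr flip: powr_realpow)
    finally have b2: "(16 * F / (q * \<delta> * \<eta> n)) ^ m \<le> (16 * F / Q) ^ m * real n powr (\<gamma> * real m)" by simp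
    \<comment> \<open>This accounts for the constant in \<open>W\<close>: a quarter of
      \<open>Q / 2\<close> is \<open>Q / 8\<close>.\<close>
    have "real n \<le> 4 * real (n div 2)"
    proof -
      have "n \<le> 4 * (n div 2)" using n(2) by linarith
      then show ?thesis by (metis of_nat_le_iff of_nat_mult of_nat_numeral)
    qed
    then have "real n / 4 \<le> real (n div 2)" by simp
    then have "Q * real n powr (- \<gamma>) / 2 * (real n / 4) \<le> Q * real n powr (- \<gamma>) / 2 * real (n div 2)"
      using Q by (intro mult_left_mono) auto
    moreover have "real n powr (1 - \<gamma>) = real n powr (- \<gamma>) * real n"
      using n powr_add[of "real n" "- \<gamma>" 1] by simp
    ultimately have b3: "exp (- (q * \<delta> * \<eta> n / 2) * real (n div 2)) \<le> exp (- (Q / 8) * real n powr (1 - \<gamma>))"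
      unfolding Q\<eta> by (simp add: mult_ac)
    have "\<bar>?I n\<bar> \<le> 4 * (B * \<sigma> n ^ (m - 2)) / c * fact m * (16 * F / (q * \<delta> * \<eta> n)) ^ m *
        exp (- (q * \<delta> * \<eta> n / 2) * real (n div 2))"
      by (rule normalized_char_integral_bound[OF f F \<sigma>n \<sigma>1 c bnn \<eta>n Q\<eta>1 \<eta>_le])
    then have "\<bar>?I n\<bar> * \<sigma> n ^ (m - 2) \<le> 4 * (B * \<sigma> n ^ (m - 2)) / c * fact m * (16 * F / (q * \<delta> * \<eta> n)) ^ m *
        exp (- (q * \<delta> * \<eta> n / 2) * real (n div 2)) * \<sigma> n ^ (m - 2)"
      using \<sigma>1 by (intro mult_right_mono) auto
    also have "\<dots> = 4 * B / c * fact m * (\<sigma> n ^ (m - 2) * \<sigma> n ^ (m - 2)) * (16 * F / (q * \<delta> * \<eta> n)) ^ m *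
        exp (- (q * \<delta> * \<eta> n / 2) * real (n div 2))"
      by (simp add: mult_ac)
    also have "\<dots> \<le> 4 * B / c * fact m * ((2 * V) ^ m * real n powr real m) * ((16 * F / Q) ^ m * real n powr (\<gamma> * real m)) *
        exp (- (Q / 8) * real n powr (1 - \<gamma>))"
      using B c F Q V(2) q\<delta> \<eta>n
      by (intro mult_mono[OF mult_mono[OF mult_left_mono[OF b1] b2] b3] mult_nonneg_nonneg)
        (simp_all add: divide_nonneg_pos zero_le_power)
    also have "\<dots> = W n" by (simp add: W_def powr_add mult_ac)
    finally have "\<bar>?I n\<bar> * \<sigma> n ^ (m - 2) \<le> W n" .
    moreover have "norm (?I n / (1 / \<sigma> n ^ (m - 2))) = \<bar>?I n\<bar> * \<sigma> n ^ (m - 2)"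
      using \<sigma>1 by (simp add: abs_mult)
    ultimately show ?case using \<sigma>1 by simp
  qed
  have "W \<longlonglongrightarrow> 4 * B / c * fact m * (2 * V) ^ m * (16 * F / Q) ^ m * 0"
    unfolding W_def using \<gamma> Q by (intro tendsto_mult_left tendsto_powr_exp_neg_powr) auto
  then have W: "W \<longlonglongrightarrow> 0" by simp
  show ?thesis
  proof (rule smalloI_tendsto)
    show "(\<lambda>n. ?I n / (1 / \<sigma> n ^ (m - 2))) \<longlonglongrightarrow> 0"
      by (rule Lim_null_comparison[OF _ W]) (use main in eventually_elim, blast)
    show "\<forall>\<^sub>F n in sequentially. 1 / \<sigma> n ^ (m - 2) \<noteq> 0"
      using main by eventually_elim simp
  qed
qed

end

section \<open>From the geometry of the manifold to the integral estimate\<close>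

theorem theorem36:
  fixes A :: "('x::{t2_space,second_countable_topology}, 'n::finite) chart set"
    and G :: "('x, 'n) chart \<Rightarrow> real^'n \<Rightarrow> real^'n^'n"
    and vol :: "'x measure"
    and p :: "'x \<Rightarrow> 'x \<Rightarrow> real"
    and M :: "'w measure"
    and \<xi> :: "nat \<Rightarrow> 'w \<Rightarrow> 'x"
    and f :: "'x \<Rightarrow> real"
    and \<alpha> V c B :: real
    and S :: "nat \<Rightarrow> 'w \<Rightarrow> real"
    and \<sigma> :: "nat \<Rightarrow> real"
    and m :: nat
  defines "S \<equiv> centered_sum M \<xi> f"
    and "\<sigma> \<equiv> (\<lambda>n. L2_norm M (S n))"
  assumes "riemannian_manifold A G"
    and "is_riemannian_volume A G vol"
    and "transition_density vol p"
    and "\<exists>K. \<forall>x y. p x y \<le> K"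
    and "\<exists>\<delta>>0. \<forall>x y. \<delta> \<le> p x y"
    and "homogeneous_markov_chain M \<xi> (markov_operator vol p)"
    and "0 < \<alpha>" and "\<alpha> \<le> 1"
    and "bounded (range f)"
    and "hoelder_continuous (riemannian_dist A G) \<alpha> f"
    and "(\<lambda>n. prob_space.variance M (S n) / real n) \<longlonglongrightarrow> V" and "V > 0"
    and "m \<ge> 3"
    and "\<alpha> < 1 \<longrightarrow> real (m - 2) < (1 + \<alpha>) / (1 - \<alpha>)"
    and "c > 0" and "B > 0"
  shows "(\<lambda>n. LBINT t:{t. c * \<sigma> n \<le> \<bar>t\<bar> \<and> \<bar>t\<bar> \<le> B * \<sigma> n ^ (m - 2)}.
            cmod (nth_derivative m (normalized_char M S n) t / complex_of_real t))
         \<in> o(\<lambda>n. 1 / \<sigma> n ^ (m - 2))"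
proof -
  note manifold = assms(3) and vol = assms(4) and density = assms(5) and chain = assms(8)
    and \<alpha> = assms(9,10) and hoel = assms(12) and V = assms(13,14) and m = assms(15,16)
  obtain \<delta> where \<delta>: "\<delta> > 0" "\<And>x y. \<delta> \<le> p x y" using assms(7) by blast
  interpret doeblin_chain vol p \<delta> M \<xi>
    by unfold_locales (use vol density chain \<delta> in \<open>auto simp: is_riemannian_volume_def\<close>)
  define \<beta> where "\<beta> = 1 / \<alpha> - 1"
  have \<beta>: "\<beta> \<ge> 0" using \<alpha> by (simp add: \<beta>_def)
  have f: "f \<in> borel_measurable borel"
    by (rule borel_measurable_continuous_onI[OF hoelder_imp_continuous[OF manifold \<alpha>(1) hoel]])
  obtain F where F: "F > 0" "\<And>x. \<bar>f x\<bar> \<le> F"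
    using assms(11) unfolding bounded_pos by auto
  \<comment> \<open>For constant \<open>f\<close> the centred sums vanish, which contradicts the
    positive limit of the normalised variances.\<close>
  have "\<exists>a b. f a \<noteq> f b"
  proof (rule ccontr)
    assume "\<not> ?thesis"
    then have "f = (\<lambda>_. f undefined)" by blast
    then obtain v where "f = (\<lambda>_. v)" by blast
    then have "S n = (\<lambda>_. 0)" for n by (simp add: S_def centered_sum_def P.prob_space fun_eq_iff)
    then have "(\<lambda>n::nat. 0 :: real) \<longlonglongrightarrow> V" using V(1) by simp
    then show False using V(2) LIMSEQ_unique tendsto_const by blast
  qed
  then obtain a b where ab: "f a \<noteq> f b" by blast
  obtain \<kappa>0 s0 where \<kappa>0: "\<kappa>0 > 0" "s0 > 0"
    "\<forall>s\<ge>s0. \<forall>\<theta>. ennreal (\<kappa>0 * s powr (1 - 1 / \<alpha>)) \<le> emeasure vol {x. cos (s * f x - \<theta>) \<le> 0}"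
    using volume_oscillation[OF manifold vol \<alpha>(1) hoel ab] by (elim exE conjE) (rule that)
  have osc: "ennreal (\<kappa>0 * s powr (- \<beta>)) \<le> emeasure vol {x \<in> space vol. cos (s * f x - \<theta>) \<le> 0}"
    if "s \<ge> s0" for s \<theta>
    using \<kappa>0(3)[rule_format, OF that, of \<theta>] by (simp add: \<beta>_def space_vol)
  have "\<exists>\<kappa>>0. \<forall>s\<ge>c. \<forall>\<theta>. \<kappa> * s powr (- \<beta>) \<le> (\<integral>x. 1 - cos (s * f x - \<theta>) \<partial>vol)"
    by (rule integral_one_minus_cos_ge[OF borel_imp_measurable[OF f] _ \<kappa>0(1,2) assms(17)]) (rule osc)
  then obtain \<kappa> where \<kappa>: "\<kappa> > 0"
    "\<forall>s\<ge>c. \<forall>\<theta>. \<kappa> * s powr (- \<beta>) \<le> (\<integral>x. 1 - cos (s * f x - \<theta>) \<partial>vol)"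
    by (elim exE conjE) (rule that)
  have decay: "norm (\<integral>x. cis (s * f x) \<partial>vol) \<le> measure vol UNIV - \<kappa> * \<bar>s\<bar> powr (- \<beta>)" if "c \<le> \<bar>s\<bar>" for s
    unfolding space_vol[symmetric]
    by (rule norm_integral_cis_le[OF borel_imp_measurable[OF f] _ that]) (use \<kappa>(2) in simp)
  \<comment> \<open>Clearing denominators and subtracting \<open>1 - \<alpha>\<close> turns the
    hypothesis on \<open>m\<close> into \<open>(m - 3) * (1 - \<alpha>) < 2 * \<alpha>\<close>;
    dividing by \<open>2 * \<alpha>\<close> gives the claim. For \<open>\<alpha> = 1\<close> the
    exponent \<open>\<beta>\<close> is 0.\<close>
  have exponent: "\<beta> * (real m - 3) / 2 < 1"
  proof (cases "\<alpha> < 1")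
    case True
    then have "real m - 2 < (1 + \<alpha>) / (1 - \<alpha>)" using m by (simp add: of_nat_diff)
    then have "(real m - 3) * (1 - \<alpha>) < 2 * \<alpha>" using True by (simp add: field_simps)
    then show ?thesis using \<alpha> by (simp add: \<beta>_def field_simps)
  qed (use \<alpha> in \<open>simp add: \<beta>_def\<close>)
  show ?thesis
    using normalized_char_integral_smallo[OF f F _ \<kappa>(1) \<beta> decay V(1)[unfolded S_def] V(2) m(1) exponent assms(17,18), of \<sigma>]
    unfolding \<sigma>_def S_def by blast
qed

end
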